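(* Let $T\in(0,\infty]$. Suppose that $g(t)=u(x,t)(dx^2+dy^2)$ is any complete smooth Ricci flow on $\mathbb{R}^2$, for $t\in(0,T)$, whose conformal factor $u$ is independent of $y$, where $(x,y)$ are the standard coordinates on $\mathbb{R}^2$. Then $$|K_{g(t)}|\leq \frac{1}{2t}$$ throughout $\mathbb{R}^2$ for every $t\in(0,T)$.
   Context: A smooth Ricci flow on a surface over a time interval $I$ is a smooth family of Riemannian metrics $g(t)$, $t\in I$, satisfying $\frac{\partial g}{\partial t}=-2K_{g(t)}\,g$, where $K_{g}$ denotes the Gauss curvature of $g$. It is called complete if $g(t)$ is a complete Riemannian metric for each $t\in I$. For $g(t)=u(dx^2+dy^2)$ with $u>0$ one has $K_{g(t)}=-\frac{1}{2u}\Delta\log u$, where $\Delta=\partial_x^2+\partial_y^2$, so the Ricci flow equation reads $u_t=\Delta\log u$. *)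

theory Defs
  imports "HOL-Analysis.Analysis"
begin

text \<open>
  Tensors on the plane are written in the standard coordinates $(x,y) = (p_1,p_2)$: a Riemannian
  metric is the field $p \mapsto (g_{ij}(p))$ of its coefficient matrices.
\<close>

type_synonym metric_field = "real^2 \<Rightarrow> real^2^2"

text \<open>Only meant for open \<^term>\<open>S\<close>, where it is the usual class $C^k$.\<close>

primrec C_k_on :: "nat \<Rightarrow> ('a::euclidean_space \<Rightarrow> real) \<Rightarrow> 'a set \<Rightarrow> bool" where
  "C_k_on 0 f S \<longleftrightarrow> continuous_on S f"
| "C_k_on (Suc k) f S \<longleftrightarrow>
     f differentiable_on S \<and> (\<forall>b\<in>Basis. C_k_on k (\<lambda>x. frechet_derivative f (at x) b) S)"

definition smooth_on :: "('a::euclidean_space \<Rightarrow> real) \<Rightarrow> 'a set \<Rightarrow> bool" where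
  "smooth_on f S \<longleftrightarrow> (\<forall>k. C_k_on k f S)"

definition riemannian_metric :: "metric_field \<Rightarrow> bool" where
  "riemannian_metric g \<longleftrightarrow>
     (\<forall>i j. smooth_on (\<lambda>p. g p $ i $ j) UNIV) \<and>
     (\<forall>p. transpose (g p) = g p \<and> (\<forall>v. v \<noteq> 0 \<longrightarrow> v \<bullet> (g p *v v) > 0))"

definition pderiv_coord :: "2 \<Rightarrow> (real^2 \<Rightarrow> real) \<Rightarrow> real^2 \<Rightarrow> real" where
  "pderiv_coord i f p = frechet_derivative f (at p) (axis i 1)"

text \<open>
  \<open>christoffel g k i j\<close> is $\Gamma^k_{ij}$, and \<open>riemann_curv g l k i j\<close> is the coefficient
  $R^l{}_{kij}$ in $R(\partial_i,\partial_j)\partial_k = R^l{}_{kij}\,\partial_l$, with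
  $R(X,Y)Z = \nabla_X\nabla_Y Z - \nabla_Y\nabla_X Z - \nabla_{[X,Y]}Z$. With this sign
  $K = \langle R(\partial_1,\partial_2)\partial_2,\partial_1\rangle / \det g$ is positive on
  round spheres.
\<close>

definition christoffel :: "metric_field \<Rightarrow> 2 \<Rightarrow> 2 \<Rightarrow> 2 \<Rightarrow> real^2 \<Rightarrow> real" where
  "christoffel g k i j p = (\<Sum>l\<in>UNIV. matrix_inv (g p) $ k $ l *
     (pderiv_coord i (\<lambda>q. g q $ j $ l) p + pderiv_coord j (\<lambda>q. g q $ i $ l) p
      - pderiv_coord l (\<lambda>q. g q $ i $ j) p)) / 2"

definition riemann_curv :: "metric_field \<Rightarrow> 2 \<Rightarrow> 2 \<Rightarrow> 2 \<Rightarrow> 2 \<Rightarrow> real^2 \<Rightarrow> real" where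
  "riemann_curv g l k i j p =
     pderiv_coord i (christoffel g l j k) p - pderiv_coord j (christoffel g l i k) p
     + (\<Sum>m\<in>UNIV. christoffel g l i m p * christoffel g m j k p
                 - christoffel g l j m p * christoffel g m i k p)"

definition gauss_curvature :: "metric_field \<Rightarrow> real^2 \<Rightarrow> real" where
  "gauss_curvature g p = (\<Sum>l\<in>UNIV. g p $ l $ 1 * riemann_curv g l 2 1 2 p) / det (g p)"

definition speed :: "metric_field \<Rightarrow> (real \<Rightarrow> real^2) \<Rightarrow> real \<Rightarrow> real" where
  "speed g c s = (let v = vector_derivative c (at s) in sqrt (v \<bullet> (g (c s) *v v)))"

text \<open>
  The library's \<^const>\<open>piecewise_C1_differentiable_on\<close> puts no bound on the derivative near the
  exceptional points, so a curve of infinite length is possible, and its \<^const>\<open>integral\<close> would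
  be \<open>0\<close>. Integrability of the speed is therefore part of admissibility.
\<close>

definition admissible_curve ::
    "metric_field \<Rightarrow> real^2 \<Rightarrow> real^2 \<Rightarrow> (real \<Rightarrow> real^2) \<Rightarrow> bool" where
  "admissible_curve g p q c \<longleftrightarrow>
     c piecewise_C1_differentiable_on {0..1} \<and> c 0 = p \<and> c 1 = q \<and>
     speed g c integrable_on {0..1}"

definition riemannian_dist :: "metric_field \<Rightarrow> real^2 \<Rightarrow> real^2 \<Rightarrow> real" where
  "riemannian_dist g p q = (INF c\<in>{c. admissible_curve g p q c}. integral {0..1} (speed g c))"

definition complete_metric :: "metric_field \<Rightarrow> bool" where
  "complete_metric g \<longleftrightarrow> Metric_space.mcomplete UNIV (riemannian_dist g)"

text \<open>Smoothness of the family is joint in time and space; \<^term>\<open>I\<close> is an open interval.\<close>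

definition smooth_ricci_flow :: "real set \<Rightarrow> (real \<Rightarrow> metric_field) \<Rightarrow> bool" where
  "smooth_ricci_flow I g \<longleftrightarrow>
     (\<forall>t\<in>I. riemannian_metric (g t)) \<and>
     (\<forall>i j. smooth_on (\<lambda>(t, p). g t p $ i $ j) (I \<times> UNIV)) \<and>
     (\<forall>t\<in>I. \<forall>p. ((\<lambda>s. g s p) has_vector_derivative
        (- 2 * gauss_curvature (g t) p) *\<^sub>R g t p) (at t))"

definition complete_ricci_flow :: "real set \<Rightarrow> (real \<Rightarrow> metric_field) \<Rightarrow> bool" where
  "complete_ricci_flow I g \<longleftrightarrow> smooth_ricci_flow I g \<and> (\<forall>t\<in>I. complete_metric (g t))"

text \<open>
  Check of the sign and normalisation conventions, ending in
  \<open>gauss_curvature_conformal\<close>: for $g = w\,(dx^2+dy^2)$ one gets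
  $K = -\frac{1}{2w}\,\Delta\log w$.
\<close>

lemma matrix_inv_mat:
  fixes c :: real assumes "c \<noteq> 0"
  shows "matrix_inv (mat c :: real^2^2) = mat (1/c)"
proof -
  have a: "(mat c :: real^2^2) ** mat (1/c) = mat 1"
    using assms by (simp add: matrix_matrix_mult_def mat_def vec_eq_iff sum_2 forall_2)
  have b: "(mat (1/c) :: real^2^2) ** mat c = mat 1"
    using assms by (simp add: matrix_matrix_mult_def mat_def vec_eq_iff sum_2 forall_2)
  have inv: "matrix_inv (mat c :: real^2^2) ** mat c = mat 1"
    unfolding matrix_inv_def by (rule someI2[where a = "mat (1/c)"]) (use a b in auto)
  have "matrix_inv (mat c) = matrix_inv (mat c) ** ((mat c :: real^2^2) ** mat (1/c))"
    unfolding a by simp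
  also have "\<dots> = (matrix_inv (mat c) ** mat c) ** mat (1/c)"
    by (rule matrix_mul_assoc)
  also have "\<dots> = mat (1/c)" unfolding inv by simp
  finally show ?thesis .
qed

lemma smooth_on_differentiable: "smooth_on w UNIV \<Longrightarrow> w differentiable (at p)"
  unfolding smooth_on_def by (metis C_k_on.simps(2) UNIV_I differentiable_on_def)

lemma differentiable_pderiv_coord:
  assumes "smooth_on w UNIV"
  shows "pderiv_coord i w differentiable (at p)"
proof -
  have "C_k_on (Suc (Suc 0)) w UNIV" using assms smooth_on_def by blast
  then have "\<forall>b\<in>Basis. (\<lambda>x. frechet_derivative w (at x) b) differentiable_on UNIV"
    by simp
  then have "(\<lambda>x. frechet_derivative w (at x) (axis i 1)) differentiable_on UNIV"
    by (simp add: axis_in_Basis_iff)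
  then show ?thesis by (simp add: differentiable_on_def pderiv_coord_def[abs_def])
qed

lemma pderiv_coord_eq:
  "(f has_derivative f') (at p) \<Longrightarrow> pderiv_coord i f p = f' (axis i 1)"
  unfolding pderiv_coord_def by (simp add: frechet_derivative_at[symmetric])

lemma has_frechet_derivative:
  "f differentiable (at p) \<Longrightarrow> (f has_derivative frechet_derivative f (at p)) (at p)"
  by (simp add: frechet_derivative_works)

lemma pderiv_coord_ln:
  assumes "w differentiable (at p)" "w p > 0"
  shows "pderiv_coord i (\<lambda>q. ln (w q)) p = pderiv_coord i w p / w p"
  apply (subst pderiv_coord_eq[where f' = "\<lambda>v. frechet_derivative w (at p) v * inverse (w p)"])
   apply (rule derivative_eq_intros has_frechet_derivative assms | simp add: assms divide_inverse)+
  apply (simp add: pderiv_coord_def divide_inverse)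
  done

lemma pderiv_coord_const: "pderiv_coord i (\<lambda>q. c) p = 0"
  by (subst pderiv_coord_eq[where f'="\<lambda>v. 0"]) auto

lemma pderiv_coord_half:
  "f differentiable (at p) \<Longrightarrow> pderiv_coord i (\<lambda>q. f q / 2) p = pderiv_coord i f p / 2"
  apply (subst pderiv_coord_eq[where f'="\<lambda>v. frechet_derivative f (at p) v / 2"])
  apply (auto intro!: derivative_eq_intros has_frechet_derivative simp: pderiv_coord_def)
  done

lemma pderiv_coord_minus_half:
  "f differentiable (at p) \<Longrightarrow> pderiv_coord i (\<lambda>q. - (f q / 2)) p = - pderiv_coord i f p / 2"
  apply (subst pderiv_coord_eq[where f'="\<lambda>v. - frechet_derivative f (at p) v / 2"])
  apply (auto intro!: derivative_eq_intros has_frechet_derivative simp: pderiv_coord_def)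
  done

lemma one_neq_two_2: "(1::2) \<noteq> 2" "(2::2) \<noteq> 1" by auto

lemma christoffel_conformal:
  assumes "smooth_on w UNIV" "\<And>p. w p > 0"
  defines "\<phi> \<equiv> \<lambda>i p. pderiv_coord i w p / w p"
  shows "christoffel (\<lambda>p. mat (w p)) k i j p =
    ((if k = j then \<phi> i p else 0) + (if k = i then \<phi> j p else 0) - (if i = j then \<phi> k p else 0)) / 2"
proof -
  have w: "w p \<noteq> 0" using assms(2)[of p] by simp
  have m: "(\<lambda>q. (mat (w q) :: real^2^2) $ a $ b) = (if a = b then w else (\<lambda>q. 0))" for a b :: 2
    by (auto simp: mat_def)
  have "k = 1 \<or> k = 2" "i = 1 \<or> i = 2" "j = 1 \<or> j = 2" using exhaust_2 by auto
  then show ?thesis unfolding christoffel_def matrix_inv_mat[OF w] m \<phi>_def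
    using w by (elim disjE) (simp_all add: sum_2 one_neq_two_2 pderiv_coord_const mat_def field_simps)
qed

lemma gauss_curvature_conformal:
  assumes s: "smooth_on w UNIV" and w: "\<And>p. w p > 0"
  shows "gauss_curvature (\<lambda>p. mat (w p)) p =
    - (\<Sum>i\<in>UNIV. pderiv_coord i (pderiv_coord i (\<lambda>q. ln (w q))) p) / (2 * w p)"
proof -
  define \<phi> where "\<phi> i = (\<lambda>p. pderiv_coord i w p / w p)" for i
  have ne: "w p \<noteq> 0" for p using w[of p] by simp
  have L: "pderiv_coord i (\<lambda>q. ln (w q)) = \<phi> i" for i
    unfolding \<phi>_def using pderiv_coord_ln[OF smooth_on_differentiable[OF s] w] by auto
  have d: "\<phi> i differentiable (at p)" for i p
    unfolding \<phi>_def using ne smooth_on_differentiable[OF s] differentiable_pderiv_coord[OF s] 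
    by (intro differentiable_divide) auto
  have C: "christoffel (\<lambda>p. mat (w p)) k i j = (\<lambda>p.
      ((if k = j then \<phi> i p else 0) + (if k = i then \<phi> j p else 0)
       - (if i = j then \<phi> k p else 0)) / 2)" for k i j
    using christoffel_conformal[OF s w] unfolding \<phi>_def by auto
  have D: "det (mat (w p)::real^2^2) = w p * w p" by (simp add: det_2 mat_def)
  show ?thesis unfolding gauss_curvature_def riemann_curv_def L C D
    using ne[of p] by (simp add: sum_2 one_neq_two_2 mat_def pderiv_coord_half[OF d]
        pderiv_coord_minus_half[OF d] pderiv_coord_const field_simps)
qed

end

theory Submission
  imports Defs
begin

text \<open>
  Put $p = 1/u$, so that $p_t = p\,p_{xx} - p_x^2$. The curvature $K = (p_{xx} - p_x^2/p)/2$ solves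
  $W_t = p\,W_{xx} + 2W^2$. The substitution $(x, u) \mapsto (\int u\,dx, 1/u)$ maps solutions to
  solutions and preserves arc length; the curvature of the transformed metric is
  $-p_{xx}/2 = -K - p_x^2/(2p)$, and it solves the same equation in the original coordinates.
  A localised maximum principle in the manner of B.-L. Chen shows $W \ge -1/(2t)$ for every solution
  $W$ on a complete flow. Applied to both functions it gives $K \ge -1/(2t)$ and
  $K \le p_{xx}/2 \le 1/(2t)$.
\<close>

section \<open>Smooth functions and partial derivatives\<close>

text \<open>The reaction term 2 W^2 pushes solutions up, so the maximum principle yields lower
  bounds only. An upper bound for K therefore needs a second solution W with K <= -W, and -p_xx/2
  qualifies because K = p_xx/2 - p_x^2/(2 p). The transformed metric explains where this function
  comes from but is never built: it is enough to check the equation for -p_xx/2. The flow is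
  controlled neither as t -> 0 nor as |x| -> infinity, so W + 1/(2 t) need not attain a minimum.
  Time is therefore restarted at some a > 0, and a barrier that is infinite at finite distance
  confines the negative values of the test function to a compact set. This compactness is where
  completeness enters: it says that the arc length s runs to infinity at both ends. Only after the
  barrier has been pushed to infinity does a tend to 0.\<close>

lemma second_derivative_nonneg_at_local_min:
  fixes f f' :: "real \<Rightarrow> real"
  assumes f: "\<forall>\<^sub>F y in nhds x. (f has_real_derivative f' y) (at y)"
    and f': "(f' has_real_derivative f'') (at x)"
    and le: "\<forall>\<^sub>F y in nhds x. f x \<le> f y"
  shows "f' x = 0" "0 \<le> f''"
proof -
  obtain d where d: "d > 0" "\<And>y. \<bar>y - x\<bar> < d \<Longrightarrow> (f has_real_derivative f' y) (at y)"
      "\<And>y. \<bar>y - x\<bar> < d \<Longrightarrow> f x \<le> f y"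
    using eventually_conj[OF f le] unfolding eventually_nhds_metric dist_real_def by auto
  show 0: "f' x = 0"
    by (rule DERIV_local_min[of f _ x d]) (use d in \<open>auto simp: abs_minus_commute\<close>)
  show "0 \<le> f''"
  proof (rule ccontr)
    assume "\<not> 0 \<le> f''"
    then obtain e where e: "e > 0" "\<And>h. 0 < h \<Longrightarrow> h < e \<Longrightarrow> f' (x + h) < 0"
      using DERIV_neg_dec_right[OF f'] 0 by (metis not_le)
    define h where "h = min d e / 2"
    have h: "0 < h" "h < d" "h < e" using d e by (auto simp: h_def)
    have "\<exists>z>x. z < x + h \<and> f (x + h) - f x = (x + h - x) * f' z"
      by (rule MVT2) (use h d in auto)
    then obtain z where z: "x < z" "z < x + h" "f (x + h) - f x = h * f' z" by auto
    have "f' z < 0" using e(2)[of "z - x"] z h by auto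
    then have "f (x + h) < f x" using z h by (smt (verit) mult_pos_neg)
    then show False using d(3)[of "x + h"] h by auto
  qed
qed

text \<open>For negative \<open>x\<close> the set \<open>{0..x}\<close> is empty and the integral
  over it is 0, so integrals from 0 to \<open>x\<close> are pulled back to \<open>{0..1}\<close>.
  The fixed domain also lets the Leibniz rule differentiate in a parameter.\<close>

lemma integral_rescaled:
  fixes f F :: "real \<Rightarrow> real"
  assumes "\<And>x. (F has_real_derivative f x) (at x)"
  shows "((\<lambda>r. x * f (x * r)) has_integral F x - F 0) {0..1}"
proof -
  have "((\<lambda>r. F (x * r)) has_vector_derivative x * f (x * r)) (at r within {0..1})" for r
  proof -
    have "((\<lambda>r. x * r) has_real_derivative x) (at r within {0..1})"
      by (auto intro!: derivative_eq_intros)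
    from DERIV_chain2[OF assms this] show ?thesis
      by (simp add: has_real_derivative_iff_has_vector_derivative mult.commute)
  qed
  then show ?thesis
    using fundamental_theorem_of_calculus[of 0 1 "\<lambda>r. F (x * r)" "\<lambda>r. x * f (x * r)"] by simp
qed

lemma has_real_derivative_integral_rescaled:
  fixes f :: "real \<Rightarrow> real"
  assumes "continuous_on UNIV f"
  shows "((\<lambda>x. integral {0..1} (\<lambda>r. x * f (x * r))) has_real_derivative f x) (at x)"
proof -
  obtain F where F: "\<And>x. (F has_vector_derivative f x) (at x)"
    using einterval_antiderivative[of "-\<infinity>" "\<infinity>" f] assms
    by (auto simp: continuous_on_eq_continuous_at)
  then have F': "\<And>x. (F has_real_derivative f x) (at x)"
    by (simp add: has_real_derivative_iff_has_vector_derivative)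
  have "integral {0..1} (\<lambda>r. x * f (x * r)) = F x - F 0" for x
    using integral_rescaled[OF F'] by (rule integral_unique)
  then show ?thesis by (auto intro!: derivative_eq_intros F')
qed

lemma continuous_on_param:
  fixes f :: "'a::topological_space \<Rightarrow> 'b::topological_space \<Rightarrow> 'c::topological_space"
  assumes "continuous_on (I \<times> UNIV) (\<lambda>(t, x). f t x)"
    and "continuous_on S g" "continuous_on S h" "g ` S \<subseteq> I"
  shows "continuous_on S (\<lambda>z. f (g z) (h z))"
  using continuous_on_compose2[OF assms(1), of S "\<lambda>z. (g z, h z)"] assms(2-)
  by (auto intro!: continuous_intros)

section \<open>Calculus of the classes \<open>C_k_on\<close>\<close>

lemma C_k_on_cong:
  assumes "open S" "\<And>x. x \<in> S \<Longrightarrow> f x = g x" "C_k_on k f S"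
  shows "C_k_on k g S"
  using assms(2,3)
proof (induction k arbitrary: f g)
  case 0
  then show ?case using continuous_on_cong[of S S f g] by simp
next
  case (Suc k)
  have d: "f differentiable (at x)" if "x \<in> S" for x
    using Suc.prems(2) that assms(1) by (metis C_k_on.simps(2) at_within_open differentiable_on_def)
  have eq: "frechet_derivative f (at x) = frechet_derivative g (at x)" if "x \<in> S" for x
    using frechet_derivative_transform_within_open[OF d[OF that] assms(1) that] Suc.prems(1) by blast
  have "g differentiable_on S"
    unfolding differentiable_on_def
  proof
    fix x assume x: "x \<in> S"
    then have "f differentiable (at x within S)" using Suc.prems(2) by (simp add: differentiable_on_def)
    then show "g differentiable (at x within S)"
      by (rule differentiable_transform_within[where d = 1]) (use x Suc.prems(1) in auto)
  qed
  moreover have "C_k_on k (\<lambda>x. frechet_derivative g (at x) b) S" if "b \<in> Basis" for b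
  proof (rule Suc.IH)
    show "C_k_on k (\<lambda>x. frechet_derivative f (at x) b) S" using Suc.prems(2) that by simp
    show "frechet_derivative f (at x) b = frechet_derivative g (at x) b" if "x \<in> S" for x
      by (simp only: eq[OF that])
  qed
  ultimately show ?case by simp
qed

lemma C_k_on_SucD: "C_k_on (Suc k) f S \<Longrightarrow> C_k_on k f S"
proof (induction k arbitrary: f)
  case 0
  then show ?case by (simp add: differentiable_imp_continuous_on)
next
  case (Suc k)
  show ?case unfolding C_k_on.simps(2)
    using Suc.prems Suc.IH by (simp del: C_k_on.simps(2) add: C_k_on.simps(2)[of "Suc k"])
qed

text \<open>Lets each closure proof name the derivative it knows; \<open>C_k_on\<close> itself
  speaks of \<open>frechet_derivative\<close>, which agrees with it on the open set.\<close>

lemma C_k_on_SucI: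
  assumes "open S"
    and "\<And>x. x \<in> S \<Longrightarrow> (f has_derivative f' x) (at x)"
    and "\<And>b. b \<in> Basis \<Longrightarrow> C_k_on k (\<lambda>x. f' x b) S"
  shows "C_k_on (Suc k) f S"
proof -
  have eq: "f' x = frechet_derivative f (at x)" if "x \<in> S" for x
    using frechet_derivative_at[OF assms(2)[OF that]] .
  have "C_k_on k (\<lambda>x. frechet_derivative f (at x) b) S" if "b \<in> Basis" for b
    by (rule C_k_on_cong[OF assms(1) _ assms(3)[OF that]]) (simp add: eq)
  moreover have "f differentiable_on S"
    using assms(2) by (meson differentiableI differentiable_at_withinI differentiable_on_def)
  ultimately show ?thesis by simp
qed

lemma C_k_on_Suc_has_derivative:
  assumes "open S" "C_k_on (Suc k) f S" "x \<in> S"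
  shows "(f has_derivative frechet_derivative f (at x)) (at x)"
  using assms by (metis C_k_on.simps(2) at_within_open differentiable_on_def frechet_derivative_works)

lemma C_k_on_const: "C_k_on k (\<lambda>x. c) S"
  by (induction k arbitrary: c) auto

lemma C_k_on_add:
  assumes "open S" "C_k_on k f S" "C_k_on k g S"
  shows "C_k_on k (\<lambda>x. f x + g x) S"
  using assms(2,3)
proof (induction k arbitrary: f g)
  case (Suc k)
  show ?case
  proof (rule C_k_on_SucI[OF assms(1)])
    show "((\<lambda>x. f x + g x) has_derivative
        (\<lambda>h. frechet_derivative f (at x) h + frechet_derivative g (at x) h)) (at x)"
      if "x \<in> S" for x
      using Suc.prems that assms(1) by (intro has_derivative_add C_k_on_Suc_has_derivative)
    show "C_k_on k (\<lambda>x. frechet_derivative f (at x) b + frechet_derivative g (at x) b) S"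
      if "b \<in> Basis" for b
      using Suc.prems that by (intro Suc.IH) auto
  qed
qed (simp add: continuous_on_add)

lemma C_k_on_mult:
  assumes "open S" "C_k_on k f S" "C_k_on k g S"
  shows "C_k_on k (\<lambda>x. f x * g x) S"
  using assms(2,3)
proof (induction k arbitrary: f g)
  case (Suc k)
  show ?case
  proof (rule C_k_on_SucI[OF assms(1)])
    show "((\<lambda>x. f x * g x) has_derivative
        (\<lambda>h. f x * frechet_derivative g (at x) h + frechet_derivative f (at x) h * g x)) (at x)"
      if "x \<in> S" for x
      using Suc.prems that assms(1) by (intro has_derivative_mult C_k_on_Suc_has_derivative)
    show "C_k_on k (\<lambda>x. f x * frechet_derivative g (at x) b + frechet_derivative f (at x) b * g x) S"
      if "b \<in> Basis" for b
    proof -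
      have "C_k_on k f S" "C_k_on k g S" using Suc.prems C_k_on_SucD by blast+
      moreover have "C_k_on k (\<lambda>x. frechet_derivative f (at x) b) S"
          "C_k_on k (\<lambda>x. frechet_derivative g (at x) b) S"
        using Suc.prems that by auto
      ultimately show ?thesis by (intro C_k_on_add assms(1) Suc.IH)
    qed
  qed
qed (simp add: continuous_on_mult)

text \<open>The derivative is built from the inverse itself and a partial derivative of
  \<open>f\<close>, so the induction closes with \<open>f\<close> fixed.\<close>

lemma C_k_on_inverse:
  assumes "open S" "C_k_on k f S" "\<And>x. x \<in> S \<Longrightarrow> f x \<noteq> 0"
  shows "C_k_on k (\<lambda>x. inverse (f x)) S"
  using assms(2)
proof (induction k)
  case (Suc k)
  show ?case
  proof (rule C_k_on_SucI[OF assms(1)])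
    show "((\<lambda>x. inverse (f x)) has_derivative
        (\<lambda>h. - 1 * (inverse (f x) * frechet_derivative f (at x) h * inverse (f x)))) (at x)"
      if "x \<in> S" for x
      using Deriv.has_derivative_inverse[OF assms(3)[OF that] C_k_on_Suc_has_derivative[OF assms(1) Suc.prems that]]
      by simp
    show "C_k_on k (\<lambda>x. - 1 * (inverse (f x) * frechet_derivative f (at x) b * inverse (f x))) S"
      if "b \<in> Basis" for b
      using Suc.IH[OF C_k_on_SucD[OF Suc.prems]] Suc.prems that
      by (intro C_k_on_mult assms(1) C_k_on_const) auto
  qed
qed (use assms(3) in \<open>simp add: continuous_on_inverse\<close>)

text \<open>\<open>C_k_on\<close> speaks of derivatives in basis directions; a map sending basis
  vectors to basis vectors keeps the chain rule among them. The intended instance is (t, x) -> (t,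
  (x, 0)).\<close>

lemma C_k_on_compose_linear:
  assumes "open S" "linear L" "L ` Basis \<subseteq> Basis" "open R" "L ` R \<subseteq> S" "C_k_on k f S"
  shows "C_k_on k (\<lambda>x. f (L x)) R"
  using assms(6)
proof (induction k arbitrary: f)
  case 0
  have "continuous_on R L" using assms(2) by (simp add: linear_continuous_on linear_conv_bounded_linear)
  with 0 assms(5) show ?case by (auto intro: continuous_on_compose2)
next
  case (Suc k)
  have L: "bounded_linear L" using assms(2) by (simp add: linear_conv_bounded_linear)
  show ?case
  proof (rule C_k_on_SucI[OF assms(4)])
    show "((\<lambda>x. f (L x)) has_derivative (\<lambda>h. frechet_derivative f (at (L x)) (L h))) (at x)"
      if "x \<in> R" for x
    proof (rule has_derivative_compose[OF bounded_linear_imp_has_derivative[OF L]])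
      show "(f has_derivative frechet_derivative f (at (L x))) (at (L x))"
        using that assms by (intro C_k_on_Suc_has_derivative[OF assms(1) Suc.prems]) auto
    qed
    show "C_k_on k (\<lambda>x. frechet_derivative f (at (L x)) (L b)) R" if "b \<in> Basis" for b
      using Suc.prems that assms(3) by (intro Suc.IH[of "\<lambda>y. frechet_derivative f (at y) (L b)"]) auto
  qed
qed

section \<open>Smoothness and partial derivatives in (t, x)\<close>

lemma smooth_on_inverse:
  "open S \<Longrightarrow> smooth_on f S \<Longrightarrow> (\<And>x. x \<in> S \<Longrightarrow> f x \<noteq> 0) \<Longrightarrow> smooth_on (\<lambda>x. inverse (f x)) S"
  by (simp add: smooth_on_def C_k_on_inverse)

lemma smooth_on_compose_linear:
  "open S \<Longrightarrow> linear L \<Longrightarrow> L ` Basis \<subseteq> Basis \<Longrightarrow> open R \<Longrightarrow> L ` R \<subseteq> S \<Longrightarrow> smooth_on f S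
    \<Longrightarrow> smooth_on (\<lambda>x. f (L x)) R"
  by (simp add: smooth_on_def C_k_on_compose_linear)

lemma smooth_on_frechet_derivative:
  assumes "smooth_on f S" "b \<in> Basis"
  shows "smooth_on (\<lambda>x. frechet_derivative f (at x) b) S"
  unfolding smooth_on_def
proof
  fix k
  have "C_k_on (Suc k) f S" using assms(1) by (simp add: smooth_on_def del: C_k_on.simps)
  then show "C_k_on k (\<lambda>x. frechet_derivative f (at x) b) S" using assms(2) by simp
qed

lemma smooth_on_has_derivative:
  assumes "open S" "smooth_on f S" "x \<in> S"
  shows "(f has_derivative frechet_derivative f (at x)) (at x)"
  using C_k_on_Suc_has_derivative[OF assms(1) _ assms(3)] assms(2) unfolding smooth_on_def by blast

text \<open>The partial derivatives come out smooth again, so the lemma can be iterated up to the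
  fourth x-derivative of 1/u.\<close>

lemma smooth_on_partial_derivatives:
  fixes f :: "real \<times> real \<Rightarrow> real"
  assumes "open S" "smooth_on f S"
  obtains f_t f_x where "smooth_on f_t S" "smooth_on f_x S"
    "\<And>t x. (t, x) \<in> S \<Longrightarrow> ((\<lambda>t. f (t, x)) has_real_derivative f_t (t, x)) (at t)"
    "\<And>t x. (t, x) \<in> S \<Longrightarrow> ((\<lambda>x. f (t, x)) has_real_derivative f_x (t, x)) (at x)"
proof
  let ?D = "\<lambda>z. frechet_derivative f (at z)"
  show "smooth_on (\<lambda>z. ?D z (1, 0)) S" "smooth_on (\<lambda>z. ?D z (0, 1)) S"
    by (rule smooth_on_frechet_derivative[OF assms(2)]; simp add: Basis_prod_def)+
  fix t x assume z: "(t, x) \<in> S"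
  have D: "(f has_derivative ?D (t, x)) (at (t, x))"
    by (rule smooth_on_has_derivative[OF assms z])
  have lin: "?D (t, x) (h, 0) = ?D (t, x) (1, 0) * h" "?D (t, x) (0, h) = ?D (t, x) (0, 1) * h" for h
    using linear_cmul[OF has_derivative_linear[OF D], of h "(1, 0)"]
      linear_cmul[OF has_derivative_linear[OF D], of h "(0, 1)"] by (simp_all only: scaleR_Pair) auto
  have "((\<lambda>t. f (t, x)) has_derivative (\<lambda>h. ?D (t, x) (h, 0))) (at t)"
    using has_derivative_compose[where f = "\<lambda>t. (t, x)", OF has_derivative_Pair[OF has_derivative_ident has_derivative_const] D] .
  then show "((\<lambda>t. f (t, x)) has_real_derivative ?D (t, x) (1, 0)) (at t)"
    unfolding has_field_derivative_def by (rule has_derivative_eq_rhs) (rule ext, rule lin)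
  have "((\<lambda>x. f (t, x)) has_derivative (\<lambda>h. ?D (t, x) (0, h))) (at x)"
    using has_derivative_compose[where f = "\<lambda>x. (t, x)", OF has_derivative_Pair[OF has_derivative_const has_derivative_ident] D] .
  then show "((\<lambda>x. f (t, x)) has_real_derivative ?D (t, x) (0, 1)) (at x)"
    unfolding has_field_derivative_def by (rule has_derivative_eq_rhs) (rule ext, rule lin)
qed

lemma smooth_on_imp_continuous_on: "smooth_on f S \<Longrightarrow> continuous_on S f"
  unfolding smooth_on_def by (metis C_k_on.simps(1))

text \<open>Write \<open>f t x - f t 0\<close> as the integral of \<open>f_x\<close>, differentiate
  under the integral in t, then differentiate the result in x. This turns the equation for p_t into
  equations for the time derivatives of p_x and p_xx.\<close>

lemma mixed_partial_derivative:
  fixes f f_t f_x f_xt :: "real \<Rightarrow> real \<Rightarrow> real"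
  assumes "open I" "t \<in> I"
    and f_x: "\<And>t x. t \<in> I \<Longrightarrow> (f t has_real_derivative f_x t x) (at x)"
    and f_t: "\<And>t x. t \<in> I \<Longrightarrow> ((\<lambda>t. f t x) has_real_derivative f_t t x) (at t)"
    and f_xt: "\<And>t x. t \<in> I \<Longrightarrow> ((\<lambda>t. f_x t x) has_real_derivative f_xt t x) (at t)"
    and cont_f_x: "continuous_on (I \<times> UNIV) (\<lambda>(t, x). f_x t x)"
    and cont_f_xt: "continuous_on (I \<times> UNIV) (\<lambda>(t, x). f_xt t x)"
  shows "(f_t t has_real_derivative f_xt t x) (at x)"
proof -
  obtain e where e: "e > 0" "ball t e \<subseteq> I" using assms(1,2) openE by blast
  define U where "U = ball t e"
  have U: "open U" "convex U" "t \<in> U" "U \<subseteq> I" using e by (auto simp: U_def)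
  have "((\<lambda>r. x * f_x t (x * r)) has_integral f t x - f t 0) {0..1}" if "t \<in> I" for t x
    using integral_rescaled[OF f_x[OF that]] .
  then have int: "f t x - f t 0 = integral {0..1} (\<lambda>r. x * f_x t (x * r))" if "t \<in> I" for t x
    using that by (metis integral_unique)
  have "f_t t x - f_t t 0 = integral {0..1} (\<lambda>r. x * f_xt t (x * r))" for x
  proof -
    have "((\<lambda>t. integral (cbox 0 1) (\<lambda>r. x * f_x t (x * r))) has_real_derivative
        integral (cbox 0 1) (\<lambda>r. x * f_xt t (x * r))) (at t within U)"
    proof (rule leibniz_rule_field_derivative)
      show "((\<lambda>t. x * f_x t (x * r)) has_real_derivative x * f_xt t (x * r)) (at t within U)"
        if "t \<in> U" for t r
        using that U by (intro DERIV_cmult DERIV_subset[OF f_xt]) auto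
      show "(\<lambda>r. x * f_x t (x * r)) integrable_on cbox 0 1" if "t \<in> U" for t
        unfolding cbox_interval using that U
        by (intro integrable_continuous_real continuous_intros continuous_on_param[OF cont_f_x]) auto
      show "continuous_on (U \<times> cbox 0 1) (\<lambda>(t, r). x * f_xt t (x * r))"
        unfolding case_prod_unfold using U by (intro continuous_intros continuous_on_param[OF cont_f_xt]) auto
    qed (use U in auto)
    then have "((\<lambda>t. integral {0..1} (\<lambda>r. x * f_x t (x * r))) has_real_derivative
        integral {0..1} (\<lambda>r. x * f_xt t (x * r))) (at t)"
      using at_within_open[OF U(3,1)] by simp
    then have "((\<lambda>t. f t x - f t 0) has_real_derivative
        integral {0..1} (\<lambda>r. x * f_xt t (x * r))) (at t)"
      by (rule DERIV_cong_ev[THEN iffD1, rotated -1])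
         (use int U in \<open>auto simp: eventually_nhds intro!: exI[of _ U]\<close>)
    moreover have "((\<lambda>t. f t x - f t 0) has_real_derivative f_t t x - f_t t 0) (at t)"
      using assms(2) by (intro DERIV_diff f_t)
    ultimately show ?thesis by (rule DERIV_unique[symmetric])
  qed
  then have "f_t t x = integral {0..1} (\<lambda>r. x * f_xt t (x * r)) + f_t t 0" for x
    by (metis diff_add_cancel)
  then have "f_t t = (\<lambda>x. integral {0..1} (\<lambda>r. x * f_xt t (x * r)) + f_t t 0)"
    by (rule ext)
  moreover have "((\<lambda>x. integral {0..1} (\<lambda>r. x * f_xt t (x * r)) + f_t t 0) has_real_derivative
      f_xt t x + 0) (at x)"
    using assms(2)
    by (intro DERIV_add DERIV_const has_real_derivative_integral_rescaled continuous_on_param[OF cont_f_xt]) auto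
  ultimately show ?thesis by simp
qed

section \<open>The maximum principle\<close>

text \<open>Chain rule for the barrier B(d) = 3/(A-d)^2, with B' = 6/(A-d)^3. It is applied to D as
  a function of x and as a function of t.\<close>

lemma has_real_derivative_barrier:
  assumes "(D has_real_derivative D') (at y)" "D y \<noteq> A"
  shows "((\<lambda>y. 3 / (A - D y)\<^sup>2) has_real_derivative 6 * D' / (A - D y) ^ 3) (at y)"
proof -
  have "((\<lambda>z. 3 / z\<^sup>2) has_real_derivative - 6 / z ^ 3) (at z)" if "z \<noteq> 0" for z :: real
    using that by (auto intro!: derivative_eq_intros simp: field_simps eval_nat_numeral)
  moreover have "((\<lambda>y. A - D y) has_real_derivative - D') (at y)"
    by (auto intro!: derivative_eq_intros assms)
  ultimately show ?thesis
    using DERIV_chain2[of "\<lambda>z. 3 / z\<^sup>2" "- 6 / (A - D y) ^ 3" "\<lambda>y. A - D y" y "- D'" UNIV] assms(2)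
    by simp
qed

text \<open>\<open>E\<close> stands for D_x, so the second summand becomes B''(D) D_x^2 with B'' =
  18/(A-d)^4.\<close>

lemma has_real_derivative_barrier':
  assumes "(D has_real_derivative D') (at y)" "(E has_real_derivative E') (at y)" "D y \<noteq> A"
  shows "((\<lambda>y. 6 * E y / (A - D y) ^ 3) has_real_derivative
    6 * E' / (A - D y) ^ 3 + 18 * (E y * D') / (A - D y) ^ 4) (at y)"
proof -
  have "((\<lambda>z. 6 / z ^ 3) has_real_derivative - 18 / z ^ 4) (at z)" if "z \<noteq> 0" for z :: real
    using that by (auto intro!: derivative_eq_intros simp: field_simps eval_nat_numeral)
  moreover have "((\<lambda>y. A - D y) has_real_derivative - D') (at y)"
    by (auto intro!: derivative_eq_intros assms)
  ultimately have "((\<lambda>y. 6 / (A - D y) ^ 3) has_real_derivative - 18 / (A - D y) ^ 4 * - D') (at y)"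
    using DERIV_chain2[of "\<lambda>z. 6 / z ^ 3" "- 18 / (A - D y) ^ 4" "\<lambda>y. A - D y" y "- D'" UNIV] assms(3)
    by simp
  from DERIV_mult'[OF assms(2) this] show ?thesis
    by (simp add: algebra_simps)
qed

text \<open>Two x-derivatives of \<open>p\<close> suffice for the arc length and its evolution. The
  function to be bounded enters the maximum principle as a separate \<open>W\<close>, so that one
  lemma serves both choices of \<open>W\<close>.\<close>

locale log_diffusion =
  fixes I :: "real set" and p p1 p2 :: "real \<Rightarrow> real \<Rightarrow> real"
  assumes open_I: "open I"
    and I_pos: "t \<in> I \<Longrightarrow> 0 < t"
    and I_down: "0 < r \<Longrightarrow> r \<le> t \<Longrightarrow> t \<in> I \<Longrightarrow> r \<in> I"
    and p_pos: "t \<in> I \<Longrightarrow> 0 < p t x"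
    and cont_p: "continuous_on (I \<times> UNIV) (\<lambda>(t, x). p t x)"
    and cont_p1: "continuous_on (I \<times> UNIV) (\<lambda>(t, x). p1 t x)"
    and cont_p2: "continuous_on (I \<times> UNIV) (\<lambda>(t, x). p2 t x)"
    and p_x: "t \<in> I \<Longrightarrow> (p t has_real_derivative p1 t x) (at x)"
    and p1_x: "t \<in> I \<Longrightarrow> (p1 t has_real_derivative p2 t x) (at x)"
    and p_t: "t \<in> I \<Longrightarrow>
      ((\<lambda>t. p t x) has_real_derivative p t x * p2 t x - (p1 t x)\<^sup>2) (at t)"
begin

text \<open>
  The signed arc length $\int_0^x p^{-1/2}$, rescaled to $[0,1]$ so that one formula covers both signs
  of $x$.
\<close>

definition s :: "real \<Rightarrow> real \<Rightarrow> real" where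
  "s t x = integral {0..1} (\<lambda>r. x * (1 / sqrt (p t (x * r))))"

text \<open>This is p s_xx, the Laplacian of the signed arc length; geometrically it is the geodesic
  curvature (up to orientation) of the lines x = const.\<close>

definition \<rho> :: "real \<Rightarrow> real \<Rightarrow> real" where
  "\<rho> t x = - p1 t x / (2 * sqrt (p t x))"

text \<open>The integrand is the time derivative of p^(-1/2) with the equation for p inserted. It
  equals -K p^(-1/2): under the flow, length elements shrink at rate K.\<close>

definition s_t :: "real \<Rightarrow> real \<Rightarrow> real" where
  "s_t t x = integral {0..1} (\<lambda>r. x *
     (- (p t (x * r) * p2 t (x * r) - (p1 t (x * r))\<^sup>2) / (2 * p t (x * r) * sqrt (p t (x * r)))))"

section \<open>The signed arc length: derivatives, sign, evolution and properness\<close>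

lemma p_nz: "t \<in> I \<Longrightarrow> p t x \<noteq> 0"
  using p_pos[of t x] by simp

lemma continuous_on_slice:
  assumes "continuous_on (I \<times> UNIV) (\<lambda>(t, x). f t x)" "t \<in> I"
  shows "continuous_on S (f t)"
  by (rule continuous_on_param[OF assms(1)]) (use assms(2) in \<open>auto intro!: continuous_intros\<close>)

lemma s_x:
  assumes "t \<in> I"
  shows "(s t has_real_derivative 1 / sqrt (p t x)) (at x)"
  unfolding s_def[abs_def]
proof (rule has_real_derivative_integral_rescaled)
  show "continuous_on UNIV (\<lambda>x. 1 / sqrt (p t x))"
    using p_pos[OF assms] by (intro continuous_intros continuous_on_slice[OF cont_p assms]) (simp add: less_le)
qed

lemma s_xx:
  assumes "t \<in> I"
  shows "((\<lambda>x. 1 / sqrt (p t x)) has_real_derivative - p1 t x / (2 * p t x * sqrt (p t x))) (at x)"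
  using p_pos[OF assms, of x]
  by (auto intro!: derivative_eq_intros p_x assms simp: field_simps)

text \<open>A multiplicative form of "\<open>s\<close> has the sign of \<open>x\<close>". Against
  the term \<open>x * h\<close> of \<open>s_heat\<close> it produces x^2 m h >= 0.\<close>

lemma s_sgn:
  assumes "t \<in> I"
  obtains m where "0 \<le> m" "s t x = x * m"
proof
  show "s t x = x * integral {0..1} (\<lambda>r. 1 / sqrt (p t (x * r)))"
    unfolding s_def by (rule integral_mult_right)
  show "0 \<le> integral {0..1} (\<lambda>r. 1 / sqrt (p t (x * r)))"
  proof (rule integral_nonneg)
    show "(\<lambda>r. 1 / sqrt (p t (x * r))) integrable_on {0..1}"
      using p_pos[OF assms]
      by (intro integrable_continuous_real continuous_intros continuous_on_param[OF cont_p])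
         (auto simp: assms less_le)
  qed (use p_pos[OF assms] in \<open>auto intro: less_imp_le\<close>)
qed

lemma continuous_on_s: "continuous_on (I \<times> UNIV) (\<lambda>(t, x). s t x)"
proof -
  have "continuous_on ((I \<times> UNIV) \<times> cbox 0 1) (\<lambda>(z, r). snd z * (1 / sqrt (p (fst z) (snd z * r))))"
    unfolding case_prod_unfold
    by (intro continuous_intros continuous_on_param[OF cont_p]) (auto simp: p_nz)
  from integral_continuous_on_param[OF this]
  show ?thesis by (simp add: s_def case_prod_unfold)
qed

lemma s_deriv_t:
  assumes "t \<in> I"
  shows "((\<lambda>t. s t x) has_real_derivative s_t t x) (at t)"
proof -
  obtain e where e: "e > 0" "ball t e \<subseteq> I"
    using open_I assms openE by blast
  define U where "U = ball t e"
  have U: "open U" "convex U" "t \<in> U" "U \<subseteq> I" using e by (auto simp: U_def)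
  have "((\<lambda>t. integral (cbox 0 1) (\<lambda>r. x * (1 / sqrt (p t (x * r))))) has_field_derivative
     integral (cbox 0 1) (\<lambda>r. x *
     (- (p t (x * r) * p2 t (x * r) - (p1 t (x * r))\<^sup>2) / (2 * p t (x * r) * sqrt (p t (x * r))))))
     (at t within U)"
  proof (rule leibniz_rule_field_derivative)
    fix t r assume "t \<in> U"
    then have t: "t \<in> I" using U by auto
    show "((\<lambda>t. x * (1 / sqrt (p t (x * r)))) has_field_derivative
        x * (- (p t (x * r) * p2 t (x * r) - (p1 t (x * r))\<^sup>2) / (2 * p t (x * r) * sqrt (p t (x * r)))))
        (at t within U)"
      using p_pos[OF t, of "x * r"]
      by (auto intro!: derivative_eq_intros DERIV_subset[OF p_t[OF t]] simp: field_simps)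
  next
    fix t assume "t \<in> U"
    then have t: "t \<in> I" using U by auto
    show "(\<lambda>r. x * (1 / sqrt (p t (x * r)))) integrable_on cbox 0 1"
      unfolding cbox_interval using p_pos[OF t]
      by (intro integrable_continuous_real continuous_intros continuous_on_param[OF cont_p])
         (auto simp: t less_le)
  next
    show "continuous_on (U \<times> cbox 0 1) (\<lambda>(t, r). x *
     (- (p t (x * r) * p2 t (x * r) - (p1 t (x * r))\<^sup>2) / (2 * p t (x * r) * sqrt (p t (x * r)))))"
      unfolding case_prod_unfold
      by (intro continuous_intros continuous_on_param[OF cont_p] continuous_on_param[OF cont_p1]
          continuous_on_param[OF cont_p2]) (use U(4) in \<open>auto simp: p_nz\<close>)
  qed (use U in auto)
  then show ?thesis
    using at_within_open[OF U(3,1)] by (simp add: s_def[abs_def] s_t_def)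
qed

text \<open>
  With $\Delta = p\,\partial_x^2$ the Laplacian on functions of $x$, the identity reads
  $(\partial_t - \Delta)\,s = -\rho(t,0) + \int_0^s \rho^2\,ds$. The integral has the sign of $s$,
  so the distance $|s|$ is a supersolution up to the bounded term $|\rho(t,0)|$, with no curvature
  assumption.
\<close>

lemma s_heat:
  assumes "t \<in> I"
  obtains h where "0 \<le> h" "s_t t x - p t x * (- p1 t x / (2 * p t x * sqrt (p t x))) = - \<rho> t 0 + x * h"
proof
  \<comment> \<open>This is \<rho>^2 s_x, the integrand of the good term.\<close>
  define h where "h y = (p1 t y)\<^sup>2 / (4 * p t y * sqrt (p t y))" for y
  define \<rho>' where "\<rho>' y = - (p2 t y / (2 * sqrt (p t y))) + h y" for y
  have pos: "p t y > 0" for y using p_pos[OF assms] .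
  have h_int: "(\<lambda>r. h (x * r)) integrable_on {0..1}" unfolding h_def using pos
    by (intro integrable_continuous_real continuous_intros continuous_on_param[OF cont_p]
        continuous_on_param[OF cont_p1]) (auto simp: assms less_le)
  have D: "(\<rho> t has_real_derivative \<rho>' y) (at y)" for y
  proof -
    have "((\<lambda>y. p1 t y * (1 / sqrt (p t y)) * (- 1 / 2)) has_real_derivative
        (p1 t y * (- p1 t y / (2 * p t y * sqrt (p t y))) + p2 t y * (1 / sqrt (p t y))) * (- 1 / 2)) (at y)"
      by (intro DERIV_cmult_right DERIV_mult' p1_x s_xx assms)
    moreover have "(\<lambda>y. p1 t y * (1 / sqrt (p t y)) * (- 1 / 2)) = \<rho> t"
      by (auto simp: \<rho>_def)
    moreover have "(p1 t y * (- p1 t y / (2 * p t y * sqrt (p t y))) + p2 t y * (1 / sqrt (p t y))) * (- 1 / 2) = \<rho>' y"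
      unfolding \<rho>'_def h_def using pos[of y] by (simp add: field_simps power2_eq_square)
    ultimately show ?thesis by simp
  qed
  \<comment> \<open>The left side is -K s_x. The identity is the Riccati equation \<rho>_x = -(K +
    \<rho>^2) s_x, which trades the curvature for an exact derivative plus a square.\<close>
  have eq: "- (p t y * p2 t y - (p1 t y)\<^sup>2) / (2 * p t y * sqrt (p t y)) = \<rho>' y + h y" for y
    unfolding \<rho>'_def h_def using pos[of y] by (simp add: field_simps)
  have "((\<lambda>r. x * \<rho>' (x * r) + x * h (x * r)) has_integral
      (\<rho> t x - \<rho> t 0 + x * integral {0..1} (\<lambda>r. h (x * r)))) {0..1}"
    by (intro has_integral_add integral_rescaled D has_integral_mult_right integrable_integral h_int)
  then have "s_t t x = \<rho> t x - \<rho> t 0 + x * integral {0..1} (\<lambda>r. h (x * r))"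
    unfolding s_t_def eq by (simp add: integral_unique distrib_left)
  moreover have "p t x * (- p1 t x / (2 * p t x * sqrt (p t x))) = \<rho> t x"
    using pos[of x] by (simp add: \<rho>_def)
  ultimately show "s_t t x - p t x * (- p1 t x / (2 * p t x * sqrt (p t x))) =
      - \<rho> t 0 + x * integral {0..1} (\<lambda>r. h (x * r))" by simp
  show "0 \<le> integral {0..1} (\<lambda>r. h (x * r))"
    by (rule integral_nonneg[OF h_int]) (auto simp: h_def intro!: divide_nonneg_nonneg mult_nonneg_nonneg less_imp_le[OF pos])
qed

lemma s_strict_mono:
  assumes "t \<in> I" "x < y" shows "s t x < s t y"
  by (rule DERIV_pos_imp_increasing[OF assms(2)])
     (use s_x[OF assms(1)] p_pos[OF assms(1)] in force)

text \<open>Completeness is known for each time separately. Continuity of \<open>s\<close> in t at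
  two fixed points, with monotonicity in x, makes one \<open>X\<close> work for nearby times; a
  Bolzano argument then covers \<open>{a..b}\<close>.\<close>

lemma s_proper:
  assumes unb: "\<And>t B. t \<in> I \<Longrightarrow> (\<exists>x. B < s t x) \<and> (\<exists>x. s t x < B)"
    and ab: "{a..b} \<subseteq> I" "a \<le> b"
  obtains X where "0 < X" "\<And>t x. t \<in> {a..b} \<Longrightarrow> \<bar>s t x\<bar> \<le> A \<Longrightarrow> \<bar>x\<bar> \<le> X"
proof -
  \<comment> \<open>The intersection is needed because the local step of \<open>Bolzano\<close>
    ranges over intervals that may stick out of \<open>{a..b}\<close>.\<close>
  define P where "P c d \<longleftrightarrow> (\<exists>X>0. \<forall>t\<in>{c..d} \<inter> {a..b}. A < s t X \<and> s t (- X) < - A)" for c d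
  have mono: "A < s t Y \<and> s t (- Y) < - A" if "t \<in> {a..b}" "A < s t X" "s t (- X) < - A" "X \<le> Y" for t X Y
  proof -
    have "t \<in> I" using that ab by auto
    then have "s t X \<le> s t Y" "s t (- Y) \<le> s t (- X)"
      using s_strict_mono[of t X Y] s_strict_mono[of t "-Y" "-X"] that(4) by fastforce+
    then show ?thesis using that by linarith
  qed
  have "P a b" using ab(2)
  proof (induct rule: Bolzano)
    case (trans c d e)
    then obtain X Y where "X > 0" "\<forall>t\<in>{c..d} \<inter> {a..b}. A < s t X \<and> s t (- X) < - A"
       "Y > 0" "\<forall>t\<in>{d..e} \<inter> {a..b}. A < s t Y \<and> s t (- Y) < - A" unfolding P_def by auto
    then have "max X Y > 0 \<and> (\<forall>t\<in>{c..e} \<inter> {a..b}. A < s t (max X Y) \<and> s t (- max X Y) < - A)"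
      using mono[of _ X "max X Y"] mono[of _ Y "max X Y"] trans(3,4)
      by (metis (no_types, lifting) IntD1 IntD2 IntI atLeastAtMost_iff less_max_iff_disj max.cobounded1
          max.cobounded2 nle_le)
    then show ?case unfolding P_def by blast
  next
    case (local t)
    then have t: "t \<in> I" "t \<in> {a..b}" using ab by auto
    obtain x y where "A < s t x" "s t y < - A" using unb[OF t(1)] by metis
    define X where "X = max 1 (max \<bar>x\<bar> \<bar>y\<bar>)"
    have le: "x \<le> X" "- X \<le> y" "X > 0" by (auto simp: X_def)
    have "s t x \<le> s t X" "s t (- X) \<le> s t y"
      using s_strict_mono[OF t(1), of x X] s_strict_mono[OF t(1), of "- X" y] le by fastforce+
    then have X: "A < s t X" "s t (- X) < - A" using \<open>A < s t x\<close> \<open>s t y < - A\<close> by auto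
    have "((\<lambda>t. s t X) \<longlongrightarrow> s t X) (at t)" "((\<lambda>t. s t (- X)) \<longlongrightarrow> s t (- X)) (at t)"
      using DERIV_isCont[OF s_deriv_t[OF t(1)]] by (auto simp: isCont_def)
    then have "\<forall>\<^sub>F r in at t. A < s r X \<and> s r (- X) < - A"
      using X by (intro eventually_conj order_tendstoD)
    then obtain d where d: "d > 0" "\<And>r. r \<noteq> t \<Longrightarrow> dist r t < d \<Longrightarrow> A < s r X \<and> s r (- X) < - A"
      unfolding eventually_at by blast
    then have d': "\<And>r. \<bar>r - t\<bar> < d \<Longrightarrow> A < s r X \<and> s r (- X) < - A"
      using X unfolding dist_real_def by metis
    show ?case
    proof (intro exI conjI allI impI)
      fix a' b' assume "a' \<le> t \<and> t \<le> b' \<and> b' - a' < d"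
      then show "P a' b'" unfolding P_def using le(3) by (intro exI[of _ X]) (auto intro!: d')
    qed (fact d)
  qed
  then obtain X where X: "X > 0" "\<And>t. t \<in> {a..b} \<Longrightarrow> A < s t X \<and> s t (- X) < - A"
    unfolding P_def by auto
  show ?thesis
  proof (rule that[OF X(1)])
    fix t x assume t: "t \<in> {a..b}" and le: "\<bar>s t x\<bar> \<le> A"
    then have "\<not> X < x" "\<not> x < - X"
      using X(2)[OF t] s_strict_mono[of t X x] s_strict_mono[of t x "- X"] ab by fastforce+
    then show "\<bar>x\<bar> \<le> X" by auto
  qed
qed

text \<open>
  The barrier $B(d) = 3/(A-d)^2$ solves $B'' = 2B^2$ and blows up at $d = A$, which matches the
  reaction term $2W^2$.
\<close>

lemma barrier_lower_bound:
  assumes unb: "\<And>t B. t \<in> I \<Longrightarrow> (\<exists>x. B < s t x) \<and> (\<exists>x. s t x < B)"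
    and W_cont: "continuous_on (I \<times> UNIV) (\<lambda>(t, x). W t x)"
    and W_x: "\<And>t x. t \<in> I \<Longrightarrow> (W t has_real_derivative Wx t x) (at x)"
    and W_xx: "\<And>t x. t \<in> I \<Longrightarrow> (Wx t has_real_derivative Wxx t x) (at x)"
    and W_t: "\<And>t x. t \<in> I \<Longrightarrow>
      ((\<lambda>t. W t x) has_real_derivative p t x * Wxx t x + 2 * (W t x)\<^sup>2) (at t)"
    and ab: "0 < a" "a < b" "b \<in> I"
    and M: "\<And>t. t \<in> {a..b} \<Longrightarrow> \<bar>\<rho> t 0\<bar> \<le> M"
    and A: "sqrt (1 + (s b x0)\<^sup>2) + (M + 1) * (b - a) < A"
  shows "- 1 / (2 * (b - a)) - 3 / (A - (sqrt (1 + (s b x0)\<^sup>2) + (M + 1) * (b - a)))\<^sup>2 \<le> W b x0"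
proof -
  have ab_I: "{a..b} \<subseteq> I" using I_down ab by force
  have "M \<ge> 0" using M[of a] ab by auto
  \<comment> \<open>sqrt(1 + s^2) replaces |s|, which is not differentiable at s = 0. The drift
    makes D a supersolution: M absorbs \<rho>(t,0), and 1 absorbs the second derivative of the
    smoothed absolute value.\<close>
  define D where "D t x = sqrt (1 + (s t x)\<^sup>2) + (M + 1) * (t - a)" for t x
  \<comment> \<open>-1/(2(t-a)) solves W' = 2 W^2 and tends to -infinity as t decreases to a; it is
    the barrier in time.\<close>
  define F where "F t x = W t x + 1 / (2 * (t - a)) + 3 / (A - D t x)\<^sup>2" for t x
  obtain X where X: "0 < X" "\<And>t x. t \<in> {a..b} \<Longrightarrow> \<bar>s t x\<bar> \<le> A \<Longrightarrow> \<bar>x\<bar> \<le> X"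
    using s_proper[OF unb ab_I less_imp_le[OF ab(2)], of A] by blast
  have s_less_D: "\<bar>s t x\<bar> < D t x" if "t \<in> {a..b}" for t x
  proof -
    have "\<bar>s t x\<bar> = sqrt ((s t x)\<^sup>2)" by simp
    also have "\<dots> < sqrt (1 + (s t x)\<^sup>2)" by (simp del: real_sqrt_abs)
    also have "\<dots> \<le> D t x" unfolding D_def using that \<open>M \<ge> 0\<close> by simp
    finally show ?thesis .
  qed
  have D_cont: "continuous_on (I \<times> UNIV) (\<lambda>(t, x). D t x)"
    using continuous_on_s unfolding D_def case_prod_unfold by (intro continuous_intros)
  have "\<exists>m>0. \<forall>z\<in>{a..b} \<times> {-X..X}. \<bar>case z of (t, x) \<Rightarrow> W t x\<bar> < m"
  proof -
    have "compact ((\<lambda>(t, x). W t x) ` ({a..b} \<times> {-X..X}))"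
      using ab_I by (intro compact_continuous_image continuous_on_subset[OF W_cont] compact_Times) auto
    from compact_imp_bounded[OF this] show ?thesis unfolding bounded_pos_less by fastforce
  qed
  then obtain m where m: "m > 0" "\<And>t x. t \<in> {a..b} \<Longrightarrow> \<bar>x\<bar> \<le> X \<Longrightarrow> \<bar>W t x\<bar> < m"
    by (force simp: abs_le_iff)
  \<comment> \<open>With \<open>\<eta>\<close>, these are the thresholds at which one barrier term
    alone reaches \<open>m\<close>: 1/(2 \<delta>) = m and 3/\<eta>^2 = m. Closer to the
    singularities F is positive.\<close>
  define \<delta> where "\<delta> = 1 / (2 * m)"
  define \<eta> where "\<eta> = sqrt (3 / m)"
  have pos: "\<delta> > 0" "\<eta> > 0" using m by (auto simp: \<delta>_def \<eta>_def)
  have neg: "\<delta> < t - a \<and> \<eta> < A - D t x"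
    if "t \<in> {a<..b}" "D t x < A" "F t x < 0" for t x
  proof -
    have "\<bar>x\<bar> \<le> X" using X(2)[of t x] s_less_D[of t x] that by auto
    then have "- m < W t x" using m(2)[of t x] that by auto
    moreover have "0 < 1 / (2 * (t - a))" "0 < 3 / (A - D t x)\<^sup>2" using that by auto
    ultimately have 1: "1 / (2 * (t - a)) < m" "3 / (A - D t x)\<^sup>2 < m"
      using that(3) unfolding F_def by linarith+
    have "\<delta> < t - a" using 1(1) that m unfolding \<delta>_def by (auto simp: field_simps)
    moreover have "\<eta> < A - D t x"
    proof -
      have "3 / m < (A - D t x)\<^sup>2" using 1(2) that m by (simp add: field_simps)
      then have "\<eta> < sqrt ((A - D t x)\<^sup>2)" unfolding \<eta>_def by (simp only: real_sqrt_less_iff)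
      then show ?thesis using that by simp
    qed
    ultimately show ?thesis by simp
  qed
  have "0 \<le> F b x0"
  proof (rule ccontr)
    assume "\<not> 0 \<le> F b x0"
    then have F0: "F b x0 < 0" by simp
    have D0: "D b x0 < A" using A by (simp add: D_def)
    \<comment> \<open>A compact set away from both singularities that contains every point with t in
      (a, b], D < A and F < 0. The bound on x follows from the bound on D, so it creates no face of
      its own.\<close>
    define Z where "Z = {z \<in> {a + \<delta>..b} \<times> {- X..X}. D (fst z) (snd z) \<le> A - \<eta>}"
    have Z_sub: "Z \<subseteq> I \<times> UNIV" using ab_I pos by (force simp: Z_def)
    have Z_mem: "(t, x) \<in> Z" if "t \<in> {a + \<delta>..b}" "D t x \<le> A - \<eta>" for t x
    proof -
      have "t \<in> {a..b}" "\<bar>s t x\<bar> \<le> A" using that s_less_D[of t x] pos by auto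
      then have "\<bar>x\<bar> \<le> X" by (rule X(2))
      then show ?thesis using that by (auto simp: Z_def)
    qed
    have "compact Z"
    proof -
      have "closed Z" unfolding Z_def
        by (rule continuous_on_closed_Collect_le)
           (use ab_I pos in \<open>auto intro!: continuous_intros closed_Times continuous_on_param[OF D_cont]\<close>)
      moreover have "Z \<subseteq> {a + \<delta>..b} \<times> {- X..X}" by (auto simp: Z_def)
      ultimately show ?thesis
        using compact_Int_closed[of "{a + \<delta>..b} \<times> {- X..X}" Z] by (simp add: compact_Times Int_absorb1)
    qed
    moreover have "(b, x0) \<in> Z"
      using neg[of b x0] F0 D0 ab by (intro Z_mem) auto
    moreover have "continuous_on Z (\<lambda>z. F (fst z) (snd z))"
    proof -
      have "\<forall>z\<in>Z. fst z - a \<noteq> 0" "\<forall>z\<in>Z. A - D (fst z) (snd z) \<noteq> 0"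
        using pos by (auto simp: Z_def)
      then show ?thesis unfolding F_def using Z_sub
        by (intro continuous_intros continuous_on_param[OF W_cont] continuous_on_param[OF D_cont])
           auto
    qed
    ultimately obtain t x where P: "(t, x) \<in> Z" and min: "\<And>t' x'. (t', x') \<in> Z \<Longrightarrow> F t x \<le> F t' x'"
      using continuous_attains_inf[of Z "\<lambda>z. F (fst z) (snd z)"] by fastforce
    have neg_P: "F t x < 0" using min[OF \<open>(b, x0) \<in> Z\<close>] F0 by simp
    have t: "a < t" "t \<le> b" "D t x < A" using P pos by (auto simp: Z_def)
    have tI: "t \<in> I" using t ab_I by auto
    \<comment> \<open>The minimum is off the faces t = a + \<delta> and D = A - \<eta>, so it is
      interior in x and earlier times can be compared. Only t = b remains possible as a boundary
      case.\<close>
    have strict: "\<delta> < t - a" "\<eta> < A - D t x" using neg[of t x] neg_P t by auto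
    define Sx where "Sx y = 1 / sqrt (p t y)" for y
    define Sxx where "Sxx y = - p1 t y / (2 * p t y * sqrt (p t y))" for y
    define R where "R y = sqrt (1 + (s t y)\<^sup>2)" for y
    define Dx where "Dx y = s t y * Sx y / R y" for y
    define Dxx where "Dxx = (s t x * Sxx x + (Sx x)\<^sup>2) / R x - (s t x * Sx x)\<^sup>2 / R x ^ 3"
    define Dt where "Dt = s t x * s_t t x / R x + (M + 1)"
    have sq: "1 + z\<^sup>2 \<noteq> 0" "\<not> 1 + z\<^sup>2 < 0" "0 < 1 + z\<^sup>2" for z :: real
      using zero_le_power2[of z] by linarith+
    have R_pos: "R y > 0" for y unfolding R_def by (simp add: sq)
    have R_sq: "(R y)\<^sup>2 = 1 + (s t y)\<^sup>2" for y unfolding R_def by simp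
    have R_x: "(R has_real_derivative Dx y) (at y)" for y
      unfolding R_def[abs_def] Dx_def Sx_def
      by (auto intro!: derivative_eq_intros s_x tI simp: R_def sq field_simps)
    have D_x: "(D t has_real_derivative Dx y) (at y)" for y
      using DERIV_add[OF R_x[of y] DERIV_const[of "(M + 1) * (t - a)"]]
      unfolding D_def[abs_def] R_def by simp
    have D_xx: "(Dx has_real_derivative Dxx) (at x)"
    proof -
      have "((\<lambda>y. s t y * Sx y) has_real_derivative s t x * Sxx x + Sx x * Sx x) (at x)"
        using DERIV_mult'[OF s_x[OF tI] s_xx[OF tI]] unfolding Sx_def Sxx_def .
      from DERIV_divide[OF this R_x[of x]] have
        "(Dx has_real_derivative ((s t x * Sxx x + Sx x * Sx x) * R x - s t x * Sx x * Dx x) / (R x * R x)) (at x)"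
        using R_pos[of x] unfolding Dx_def[abs_def] by simp
      moreover have "((s t x * Sxx x + Sx x * Sx x) * R x - s t x * Sx x * Dx x) / (R x * R x) = Dxx"
        unfolding Dxx_def Dx_def using R_pos[of x]
        by (simp add: field_simps power2_eq_square power3_eq_cube)
      ultimately show ?thesis by simp
    qed
    have D_t: "((\<lambda>t. D t x) has_real_derivative Dt) (at t)"
      unfolding D_def Dt_def R_def
      by (auto intro!: derivative_eq_intros s_deriv_t tI simp: sq field_simps)
    define q where "q = A - D t x"
    have q: "q > 0" using t(3) by (simp add: q_def)
    define Fx where "Fx y = Wx t y + 6 * Dx y / (A - D t y) ^ 3" for y
    \<comment> \<open>The strict inequality persists nearby: neighbouring points on the slice stay
      in \<open>Z\<close>, and F is differentiable there.\<close>
    have lt_x: "\<forall>\<^sub>F y in nhds x. D t y < A - \<eta>"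
      using order_tendstoD(2)[OF isCont_tendsto_compose[OF DERIV_isCont[OF D_x] filterlim_ident], of x "A - \<eta>"] strict
      by simp
    have F_x: "\<forall>\<^sub>F y in nhds x. (F t has_real_derivative Fx y) (at y)"
      using lt_x
    proof eventually_elim
      case (elim y)
      then have "A - D t y > 0" using pos by simp
      then show ?case unfolding F_def[abs_def] Fx_def
        using DERIV_add[OF DERIV_add[OF W_x[OF tI] DERIV_const] has_real_derivative_barrier[OF D_x]]
        by simp
    qed
    have F_xx: "(Fx has_real_derivative Wxx t x + 6 * Dxx / q ^ 3 + 18 * (Dx x)\<^sup>2 / q ^ 4) (at x)"
      unfolding Fx_def[abs_def] q_def
      using DERIV_add[OF W_xx[OF tI] has_real_derivative_barrier'[OF D_x D_xx]] t(3)
      by (simp add: power2_eq_square add.assoc)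
    have F_t: "((\<lambda>t. F t x) has_real_derivative
        p t x * Wxx t x + 2 * (W t x)\<^sup>2 - 1 / (2 * (t - a)\<^sup>2) + 6 * Dt / q ^ 3) (at t)"
    proof -
      have "((\<lambda>t. 1 / (2 * (t - a))) has_real_derivative - 1 / (2 * (t - a)\<^sup>2)) (at t)"
      proof -
        have "((\<lambda>z. 1 / (2 * z)) has_real_derivative - 1 / (2 * z\<^sup>2)) (at z)" if "z \<noteq> 0" for z :: real
          using that by (auto intro!: derivative_eq_intros simp: field_simps power2_eq_square)
        moreover have "((\<lambda>t. t - a) has_real_derivative 1) (at t)"
          by (auto intro!: derivative_eq_intros)
        ultimately show ?thesis
          using DERIV_chain2[of "\<lambda>z. 1 / (2 * z)" "- 1 / (2 * (t - a)\<^sup>2)" "\<lambda>t. t - a" t 1 UNIV] t(1)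
          by simp
      qed
      from DERIV_add[OF DERIV_add[OF W_t[OF tI] this] has_real_derivative_barrier[OF D_t]] t(3)
      show ?thesis unfolding F_def q_def by simp
    qed
    have "\<forall>\<^sub>F y in nhds x. F t x \<le> F t y"
      using lt_x by eventually_elim (use P in \<open>auto intro!: min Z_mem simp: Z_def\<close>)
    then have xx: "0 \<le> Wxx t x + 6 * Dxx / q ^ 3 + 18 * (Dx x)\<^sup>2 / q ^ 4"
      by (rule second_derivative_nonneg_at_local_min(2)[OF F_x F_xx])
    \<comment> \<open>Since t may equal b, the comparison is with earlier times only; it gives F_t
      <= 0 rather than F_t = 0.\<close>
    have tt: "p t x * Wxx t x + 2 * (W t x)\<^sup>2 - 1 / (2 * (t - a)\<^sup>2) + 6 * Dt / q ^ 3 \<le> 0"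
    proof (rule ccontr)
      assume "\<not> ?thesis"
      then obtain e where e: "e > 0" "\<And>h. 0 < h \<Longrightarrow> h < e \<Longrightarrow> F (t - h) x < F t x"
        using DERIV_pos_inc_left[OF F_t] by (auto simp: not_le)
      have "\<forall>\<^sub>F r in nhds t. D r x < A - \<eta>"
        using order_tendstoD(2)[OF isCont_tendsto_compose[OF DERIV_isCont[OF D_t] filterlim_ident], of "A - \<eta>"] strict
        by simp
      then obtain e' where e': "e' > 0" "\<And>r. \<bar>r - t\<bar> < e' \<Longrightarrow> D r x < A - \<eta>"
        unfolding eventually_nhds_metric dist_real_def by auto
      define h where "h = Min {e, e', t - a - \<delta>} / 2"
      have "Min {e, e', t - a - \<delta>} > 0" using e e' strict by auto
      then have h: "0 < h" "h < e" "h < e'" "h < t - a - \<delta>" unfolding h_def by auto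
      have "(t - h, x) \<in> Z" using h e'(2)[of "t - h"] t by (intro Z_mem) auto
      then show False using min e(2)[OF h(1,2)] by force
    qed
    have grad: "p t x * (Dx x)\<^sup>2 \<le> 1"
    proof -
      have "p t x * (Dx x)\<^sup>2 = (s t x)\<^sup>2 / (1 + (s t x)\<^sup>2)"
        unfolding Dx_def Sx_def using p_pos[OF tI, of x] R_pos[of x]
        by (simp add: power_divide power_mult_distrib R_sq)
      also have "\<dots> \<le> 1" by (simp add: sq divide_le_eq)
      finally show ?thesis .
    qed
    have heat: "0 \<le> Dt - p t x * Dxx"
    proof -
      obtain h where h: "0 \<le> h" "s_t t x - p t x * Sxx x = - \<rho> t 0 + x * h"
        using s_heat[OF tI] unfolding Sxx_def by blast
      obtain k where k: "0 \<le> k" "s t x = x * k" using s_sgn[OF tI] by blast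
      have pS: "p t x * (Sx x)\<^sup>2 = 1"
        unfolding Sx_def using p_pos[OF tI, of x] by (simp add: power_divide)
      \<comment> \<open>With R = sqrt(1 + s^2), one has R_s = s/R and R_ss = 1/R - s^2/R^3; the
        factor p s_x^2 = 1 says that arc length has unit gradient.\<close>
      have "Dt - p t x * Dxx = s t x * (s_t t x - p t x * Sxx x) / R x + (M + 1)
          - p t x * (Sx x)\<^sup>2 / R x + (p t x * (Sx x)\<^sup>2) * (s t x)\<^sup>2 / R x ^ 3"
        unfolding Dt_def Dxx_def
        by (simp add: algebra_simps add_divide_distrib diff_divide_distrib power_mult_distrib)
      also have "\<dots> = x\<^sup>2 * (k * h) / R x - \<rho> t 0 * (s t x / R x) + (M + 1) - 1 / R x + (s t x)\<^sup>2 / R x ^ 3"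
        unfolding pS h(2) by (simp add: k(2) algebra_simps add_divide_distrib diff_divide_distrib power2_eq_square)
      also have "\<dots> \<ge> 0"
      proof -
        have "\<bar>s t x\<bar> \<le> R x" "1 \<le> R x" unfolding R_def by (auto intro: real_le_rsqrt)
        then have "\<bar>s t x / R x\<bar> \<le> 1" "1 / R x \<le> 1" using R_pos[of x] by auto
        moreover have "\<bar>\<rho> t 0 * (s t x / R x)\<bar> \<le> M * 1"
          unfolding abs_mult by (rule mult_mono) (use M[of t] t calculation \<open>M \<ge> 0\<close> in auto)
        moreover have "0 \<le> x\<^sup>2 * (k * h) / R x" "0 \<le> (s t x)\<^sup>2 / R x ^ 3"
          using h k R_pos[of x] by auto
        ultimately show ?thesis by linarith
      qed
      finally show ?thesis .
    qed
    have "0 \<le> p t x * (Wxx t x + 6 * Dxx / q ^ 3 + 18 * (Dx x)\<^sup>2 / q ^ 4)"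
      using xx p_pos[OF tI] by (simp add: less_imp_le)
    then have "2 * (W t x)\<^sup>2 \<le> 1 / (2 * (t - a)\<^sup>2) - 6 * (Dt - p t x * Dxx) / q ^ 3
        + 18 * (p t x * (Dx x)\<^sup>2) / q ^ 4"
      using tt by (simp add: algebra_simps diff_divide_distrib)
    also have "\<dots> \<le> 1 / (2 * (t - a)\<^sup>2) + 18 / q ^ 4"
    proof -
      have "0 \<le> 6 * (Dt - p t x * Dxx) / q ^ 3" using heat q by simp
      moreover have "18 * (p t x * (Dx x)\<^sup>2) / q ^ 4 \<le> 18 / q ^ 4"
        using grad q by (intro divide_right_mono) auto
      ultimately show ?thesis by linarith
    qed
    \<comment> \<open>The squares of the two barriers match the two terms on the left exactly; the
      contradiction comes from their positive cross term.\<close>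
    also have "\<dots> < 2 * (1 / (2 * (t - a)) + 3 / q\<^sup>2)\<^sup>2"
    proof -
      have "2 * (1 / (2 * \<tau>) + 3 / q\<^sup>2)\<^sup>2 = 1 / (2 * \<tau>\<^sup>2) + 18 / q ^ 4 + 6 / (\<tau> * q\<^sup>2)"
        if "\<tau> > 0" for \<tau>
        using that q by (simp add: field_simps eval_nat_numeral)
      from this[of "t - a"] have "2 * (1 / (2 * (t - a)) + 3 / q\<^sup>2)\<^sup>2 =
          1 / (2 * (t - a)\<^sup>2) + 18 / q ^ 4 + 6 / ((t - a) * q\<^sup>2)"
        using t(1) by simp
      moreover have "0 < 6 / ((t - a) * q\<^sup>2)" using t(1) q by simp
      ultimately show ?thesis by linarith
    qed
    also have "\<dots> \<le> 2 * (W t x)\<^sup>2"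
    proof -
      have "1 / (2 * (t - a)) + 3 / q\<^sup>2 \<le> - W t x" using neg_P by (simp add: F_def q_def)
      then have "(1 / (2 * (t - a)) + 3 / q\<^sup>2)\<^sup>2 \<le> (- W t x)\<^sup>2"
        using t(1) q by (intro power_mono) auto
      then show ?thesis by simp
    qed
    finally show False by simp
  qed
  then show ?thesis unfolding F_def D_def by simp
qed

end

section \<open>The two-sided curvature bound\<close>

text \<open>The last two evolution equations are x-derivatives of the one for \<open>p\<close>. In
  the second differentiation the terms p1 p3 cancel, which leaves just the square of
  \<open>p2\<close> beside the diffusion. \<open>s_unbounded\<close> is what completeness of the
  surface provides.\<close>

locale smooth_log_diffusion = log_diffusion +
  fixes p3 p4 :: "real \<Rightarrow> real \<Rightarrow> real"
  assumes p2_x: "t \<in> I \<Longrightarrow> (p2 t has_real_derivative p3 t x) (at x)"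
    and p3_x: "t \<in> I \<Longrightarrow> (p3 t has_real_derivative p4 t x) (at x)"
    and p1_t: "t \<in> I \<Longrightarrow>
      ((\<lambda>t. p1 t x) has_real_derivative p t x * p3 t x - p1 t x * p2 t x) (at t)"
    and p2_t: "t \<in> I \<Longrightarrow>
      ((\<lambda>t. p2 t x) has_real_derivative p t x * p4 t x - (p2 t x)\<^sup>2) (at t)"
    and s_unbounded: "t \<in> I \<Longrightarrow> (\<exists>x. B < s t x) \<and> (\<exists>x. s t x < B)"
begin

text \<open>The order of limits matters: \<open>M\<close> bounds \<rho>(r,0) on
  \<open>{a..t}\<close> and depends on \<open>a\<close>, so the barrier goes to infinity with
  \<open>a\<close> fixed, and then \<open>a\<close> goes to 0.\<close>

lemma riccati_lower_bound:
  assumes W_cont: "continuous_on (I \<times> UNIV) (\<lambda>(t, x). W t x)"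
    and W_x: "\<And>t x. t \<in> I \<Longrightarrow> (W t has_real_derivative Wx t x) (at x)"
    and W_xx: "\<And>t x. t \<in> I \<Longrightarrow> (Wx t has_real_derivative Wxx t x) (at x)"
    and W_t: "\<And>t x. t \<in> I \<Longrightarrow>
      ((\<lambda>t. W t x) has_real_derivative p t x * Wxx t x + 2 * (W t x)\<^sup>2) (at t)"
    and t: "t \<in> I"
  shows "- 1 / (2 * t) \<le> W t x"
proof -
  have le: "- 1 / (2 * (t - a)) \<le> W t x" if a: "0 < a" "a < t" for a
  proof -
    have "{a..t} \<subseteq> I" using I_down a t by force
    then have "continuous_on {a..t} (\<lambda>r. \<rho> r 0)"
      unfolding \<rho>_def
      by (intro continuous_intros continuous_on_param[OF cont_p] continuous_on_param[OF cont_p1])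
         (auto simp: p_nz subset_eq)
    from compact_imp_bounded[OF compact_continuous_image[OF this compact_Icc]]
    obtain M where "\<forall>r\<in>{a..t}. \<bar>\<rho> r 0\<bar> \<le> M" unfolding bounded_iff by auto
    then have M: "\<And>r. r \<in> {a..t} \<Longrightarrow> \<bar>\<rho> r 0\<bar> \<le> M" by blast
    \<comment> \<open>Here \<open>k\<close> is A - D at the point (t, x), so \<open>A\<close> is
      chosen to leave the barrier value 3/k^2 there.\<close>
    have "- 1 / (2 * (t - a)) - 3 / k\<^sup>2 \<le> W t x" if "k > 0" for k
      using barrier_lower_bound[OF s_unbounded W_cont W_x W_xx W_t a t M,
          of x "sqrt (1 + (s t x)\<^sup>2) + (M + 1) * (t - a) + k"] that by simp
    then have ev: "\<forall>\<^sub>F k in at_top. - 1 / (2 * (t - a)) - 3 / k\<^sup>2 \<le> W t x"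
      by (intro eventually_mono[OF eventually_gt_at_top[of "0::real"]])
    have "((\<lambda>k::real. 3 / k\<^sup>2) \<longlongrightarrow> 0) at_top"
      by (intro tendsto_divide_0[OF tendsto_const] filterlim_at_top_imp_at_infinity
          filterlim_pow_at_top filterlim_ident) simp
    then have "((\<lambda>k. - 1 / (2 * (t - a)) - 3 / k\<^sup>2) \<longlongrightarrow> - 1 / (2 * (t - a)) - 0) at_top"
      by (intro tendsto_intros)
    from tendsto_upperbound[OF this ev] show ?thesis by simp
  qed
  have "((\<lambda>a. - 1 / (2 * (t - a))) \<longlongrightarrow> - 1 / (2 * (t - 0))) (at_right 0)"
    using I_pos[OF t] by (intro tendsto_intros) auto
  moreover have "\<forall>\<^sub>F a in at_right 0. - 1 / (2 * (t - a)) \<le> W t x"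
    using I_pos[OF t] le unfolding eventually_at_right_field by blast
  ultimately show ?thesis
    using tendsto_upperbound[of "\<lambda>a. - 1 / (2 * (t - a))" _ "at_right 0"] by simp
qed

text \<open>The factor -1/2 is chosen so that the term -p2^2 in the equation for \<open>p2\<close>
  becomes 2 W^2.\<close>

lemma p2_upper_bound:
  assumes "t \<in> I" shows "p2 t x \<le> 1 / t"
proof -
  have "- 1 / (2 * t) \<le> - p2 t x / 2"
  proof (rule riccati_lower_bound[where W = "\<lambda>t x. - p2 t x / 2"
        and Wx = "\<lambda>t x. - p3 t x / 2" and Wxx = "\<lambda>t x. - p4 t x / 2"])
    show "continuous_on (I \<times> UNIV) (\<lambda>(t, x). - p2 t x / 2)"
      using cont_p2 unfolding case_prod_unfold by (intro continuous_intros) simp_all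
    show "((\<lambda>x. - p2 t x / 2) has_real_derivative - p3 t x / 2) (at x)" if "t \<in> I" for t x
      by (auto intro!: derivative_eq_intros p2_x that)
    show "((\<lambda>x. - p3 t x / 2) has_real_derivative - p4 t x / 2) (at x)" if "t \<in> I" for t x
      by (auto intro!: derivative_eq_intros p3_x that)
    show "((\<lambda>t. - p2 t x / 2) has_real_derivative
        p t x * (- p4 t x / 2) + 2 * (- p2 t x / 2)\<^sup>2) (at t)" if "t \<in> I" for t x
      by (auto intro!: derivative_eq_intros p2_t that simp: field_simps power2_eq_square)
  qed (fact assms)
  then show ?thesis using I_pos[OF assms] by (simp add: field_simps)
qed

definition curvature :: "real \<Rightarrow> real \<Rightarrow> real" where
  "curvature t x = (p2 t x - (p1 t x)\<^sup>2 / p t x) / 2"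

text \<open>Since p K_xx is the Laplacian of K, the required equation is the usual evolution K_t =
  Delta K + 2 K^2. It is checked as an identity of rational functions in p, ..., p4.\<close>

lemma curvature_lower_bound:
  assumes "t \<in> I" shows "- 1 / (2 * t) \<le> curvature t x"
proof (rule riccati_lower_bound[where W = curvature and
      Wx = "\<lambda>t x. p3 t x / 2 - p1 t x * p2 t x / p t x + (p1 t x)^3 / (2 * (p t x)\<^sup>2)"
      and Wxx = "\<lambda>t x. p4 t x / 2 - ((p2 t x)\<^sup>2 + p1 t x * p3 t x) / p t x
        + 5 * (p1 t x)\<^sup>2 * p2 t x / (2 * (p t x)\<^sup>2) - (p1 t x) ^ 4 / (p t x) ^ 3"])
  show "continuous_on (I \<times> UNIV) (\<lambda>(t, x). curvature t x)"
    using cont_p cont_p1 cont_p2 unfolding curvature_def case_prod_unfold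
    by (intro continuous_intros) (auto simp: p_nz)
  fix t x assume t: "t \<in> I"
  have nz: "p t x \<noteq> 0" using p_nz[OF t] .
  show "(curvature t has_real_derivative
      p3 t x / 2 - p1 t x * p2 t x / p t x + (p1 t x)^3 / (2 * (p t x)\<^sup>2)) (at x)"
    unfolding curvature_def[abs_def] using nz
    by (auto intro!: derivative_eq_intros p_x[OF t] p1_x[OF t] p2_x[OF t]
        simp: field_simps eval_nat_numeral)
  show "((\<lambda>x. p3 t x / 2 - p1 t x * p2 t x / p t x + (p1 t x)^3 / (2 * (p t x)\<^sup>2)) has_real_derivative
      p4 t x / 2 - ((p2 t x)\<^sup>2 + p1 t x * p3 t x) / p t x
        + 5 * (p1 t x)\<^sup>2 * p2 t x / (2 * (p t x)\<^sup>2) - (p1 t x) ^ 4 / (p t x) ^ 3) (at x)"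
    using nz
    by (auto intro!: derivative_eq_intros p_x[OF t] p1_x[OF t] p2_x[OF t] p3_x[OF t]
        simp: field_simps eval_nat_numeral)
  show "((\<lambda>t. curvature t x) has_real_derivative
      p t x * (p4 t x / 2 - ((p2 t x)\<^sup>2 + p1 t x * p3 t x) / p t x
        + 5 * (p1 t x)\<^sup>2 * p2 t x / (2 * (p t x)\<^sup>2) - (p1 t x) ^ 4 / (p t x) ^ 3)
      + 2 * (curvature t x)\<^sup>2) (at t)"
    unfolding curvature_def using nz
    by (auto intro!: derivative_eq_intros p_t[OF t] p1_t[OF t] p2_t[OF t]
        simp: field_simps eval_nat_numeral)
qed (fact assms)

theorem curvature_bound:
  assumes "t \<in> I" shows "\<bar>curvature t x\<bar> \<le> 1 / (2 * t)"
proof -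
  have "curvature t x \<le> p2 t x / 2" unfolding curvature_def using p_pos[OF assms, of x] by simp
  also have "\<dots> \<le> 1 / (2 * t)" using p2_upper_bound[OF assms, of x] by simp
  finally show ?thesis using curvature_lower_bound[OF assms, of x] by simp
qed

end

section \<open>Completeness and arc length\<close>

text \<open>In the coordinates (\<sigma>, y) the metric w (dx^2 + dy^2) becomes d\<sigma>^2 + w
  dy^2, so \<sigma> measures arc length along horizontal lines. The instance is a time slice of the
  flow with \<sigma> = s.\<close>

locale warped_plane =
  fixes w \<sigma> :: "real \<Rightarrow> real"
  assumes w_cont: "continuous_on UNIV w" and w_pos: "0 < w x"
    and \<sigma>_deriv: "(\<sigma> has_real_derivative sqrt (w x)) (at x)"
begin

definition G :: metric_field where "G p = mat (w (p $ 1))"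

section \<open>Speed and admissible curves\<close>

lemma speed_G: "speed G c r = sqrt (w (c r $ 1)) * norm (vector_derivative c (at r))"
proof -
  have "(mat k :: real^2^2) *v v = k *\<^sub>R v" for k :: real and v
    by (simp add: vec_eq_iff matrix_vector_mult_def mat_def sum_2 forall_2)
  then show ?thesis by (simp add: speed_def G_def Let_def real_sqrt_mult norm_eq_sqrt_inner)
qed

lemma speed_nonneg: "0 \<le> speed G c r"
  using w_pos by (simp add: speed_G less_imp_le)

lemma admissible_iff: "admissible_curve G p q c \<longleftrightarrow>
    valid_path c \<and> pathstart c = p \<and> pathfinish c = q \<and> speed G c integrable_on {0..1}"
  by (simp add: admissible_curve_def valid_path_def pathstart_def pathfinish_def)

lemma valid_path_differentiable:
  assumes "valid_path c"
  obtains S where "finite S" "\<And>r. r \<in> {0..1} - S \<Longrightarrow> c differentiable (at r)"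
  using assms unfolding valid_path_def piecewise_C1_differentiable_on_def C1_differentiable_on_eq
  by metis

lemma speed_affine:
  assumes "c differentiable (at (m * r + k))"
  shows "speed G (\<lambda>r. c (m * r + k)) r = \<bar>m\<bar> * speed G c (m * r + k)"
proof -
  have "((\<lambda>r. m * r + k) has_vector_derivative m) (at r)"
    by (auto intro!: derivative_eq_intros)
  moreover have "(c has_vector_derivative vector_derivative c (at (m * r + k))) (at (m * r + k))"
    using assms by (simp add: vector_derivative_works)
  ultimately have "((c \<circ> (\<lambda>r. m * r + k)) has_vector_derivative
      m *\<^sub>R vector_derivative c (at (m * r + k))) (at r)"
    by (rule vector_diff_chain_at)
  then show ?thesis by (simp add: speed_G o_def vector_derivative_at)
qed

lemma admissible_linepath: "admissible_curve G p q (linepath p q)"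
proof -
  have "continuous_on {0..1} (\<lambda>r. sqrt (w (linepath p q r $ 1)) * norm (q - p))"
    by (intro continuous_intros continuous_on_compose2[OF w_cont]) auto
  then show ?thesis
    by (simp add: admissible_iff speed_G[abs_def] integrable_continuous_real)
qed

section \<open>The Riemannian distance is a metric\<close>

lemma dist_le: "admissible_curve G p q c \<Longrightarrow> riemannian_dist G p q \<le> integral {0..1} (speed G c)"
  unfolding riemannian_dist_def
  by (rule cINF_lower) (auto intro!: bdd_belowI2[of _ 0] integral_nonneg speed_nonneg simp: admissible_curve_def)

lemma dist_ge:
  "(\<And>c. admissible_curve G p q c \<Longrightarrow> m \<le> integral {0..1} (speed G c)) \<Longrightarrow> m \<le> riemannian_dist G p q"
  unfolding riemannian_dist_def by (rule cINF_greatest) (use admissible_linepath in auto)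

lemma dist_nonneg: "0 \<le> riemannian_dist G p q"
  by (rule dist_ge) (auto intro!: integral_nonneg speed_nonneg simp: admissible_curve_def)

lemma dist_self: "riemannian_dist G p p = 0"
proof -
  have "riemannian_dist G p p \<le> integral {0..1} (speed G (linepath p p))"
    by (rule dist_le[OF admissible_linepath])
  also have "\<dots> = 0" by (simp add: speed_G[abs_def])
  finally show ?thesis using dist_nonneg[of p p] by simp
qed

lemma dist_sym_le: "riemannian_dist G q p \<le> riemannian_dist G p q"
proof (rule dist_ge)
  fix c assume c: "admissible_curve G p q c"
  obtain S where S: "finite S" "\<And>r. r \<in> {0..1} - S \<Longrightarrow> c differentiable (at r)"
    using c valid_path_differentiable unfolding admissible_iff by metis
  have "((\<lambda>r. speed G c (-1 *\<^sub>R r + 1)) has_integral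
      (1 / \<bar>-1\<bar> ^ DIM(real)) *\<^sub>R integral {0..1} (speed G c))
      ((\<lambda>x. (1 / -1) *\<^sub>R x + - ((1 / -1) *\<^sub>R 1)) ` cbox 0 1)"
    using c unfolding admissible_iff
    by (intro has_integral_affinity) (auto simp: integrable_integral)
  moreover have "((\<lambda>x. (1 / -1) *\<^sub>R x + - ((1 / -1) *\<^sub>R 1)) ` cbox 0 1) = {0..1::real}"
    by (simp add: image_affinity_atLeastAtMost_diff image_affinity_cbox)
  ultimately have "((\<lambda>r. speed G c (1 - r)) has_integral integral {0..1} (speed G c)) {0..1}"
    by simp
  \<comment> \<open>Where \<open>c\<close> is not differentiable, \<open>vector_derivative\<close>
    is an unspecified value, so the two speeds are compared off a finite set.\<close>
  then have int: "(speed G (reversepath c) has_integral integral {0..1} (speed G c)) {0..1}"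
  proof (rule has_integral_spike_finite[rotated -1])
    show "finite ((\<lambda>r. 1 - r) ` S)" using S by simp
    fix r assume r: "r \<in> {0..1} - (\<lambda>r. 1 - r) ` S"
    have "1 - r \<notin> S" using r image_eqI[of r "\<lambda>r. 1 - r" "1 - r" S] by auto
    then have "1 - r \<in> {0..1} - S" using r by auto
    from speed_affine[of c "-1" r 1] S(2)[OF this]
    show "speed G (reversepath c) r = speed G c (1 - r)" by (simp add: reversepath_def)
  qed
  then have "admissible_curve G q p (reversepath c)"
    using c unfolding admissible_iff by (auto simp: valid_path_imp_reverse)
  from dist_le[OF this] int show "riemannian_dist G q p \<le> integral {0..1} (speed G c)"
    by (simp add: integral_unique)
qed

lemma dist_sym: "riemannian_dist G p q = riemannian_dist G q p"
  using dist_sym_le by (rule antisym) (rule dist_sym_le)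

lemma dist_triangle: "riemannian_dist G p r \<le> riemannian_dist G p q + riemannian_dist G q r"
proof -
  have *: "riemannian_dist G p r \<le> integral {0..1} (speed G c) + integral {0..1} (speed G d)"
    if c: "admissible_curve G p q c" and d: "admissible_curve G q r d" for c d
  proof -
    obtain S where S: "finite S" "\<And>r. r \<in> {0..1} - S \<Longrightarrow> c differentiable (at r)"
      using c valid_path_differentiable unfolding admissible_iff by metis
    obtain S' where S': "finite S'" "\<And>r. r \<in> {0..1} - S' \<Longrightarrow> d differentiable (at r)"
      using d valid_path_differentiable unfolding admissible_iff by metis
    have "((\<lambda>r. 2 * speed G c (2 *\<^sub>R r + 0)) has_integral 2 * (integral {0..1} (speed G c) /\<^sub>R 2 ^ DIM(real)))
       (cbox ((0 - 0) /\<^sub>R 2) ((1 - 0) /\<^sub>R 2))"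
      using c unfolding admissible_iff
      by (intro has_integral_mult_right has_integral_affinity') (auto simp: integrable_integral)
    then have "((\<lambda>r. 2 * speed G c (2 * r)) has_integral integral {0..1} (speed G c)) {0..1/2}" by simp
    then have 1: "(speed G (c +++ d) has_integral integral {0..1} (speed G c)) {0..1/2}"
    proof (rule has_integral_spike_finite[rotated -1])
      \<comment> \<open>Besides the bad points of \<open>c\<close>, the junction 1/2 is excluded,
        where the joined path may have a corner.\<close>
      show "finite (insert (1/2) ((\<lambda>r. r / 2) ` S))" using S by simp
      fix r assume r: "r \<in> {0..1/2} - insert (1/2) ((\<lambda>r. r / 2) ` S)"
      have "2 * r \<notin> S" using r image_eqI[of r "\<lambda>r. r / 2" "2 * r" S] by auto
      then have r': "r < 1/2" "2 * r \<in> {0..1} - S" using r by auto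
      have "vector_derivative (c +++ d) (at r) = vector_derivative (\<lambda>r. c (2 * r)) (at r)"
      proof (rule vector_derivative_cong_eq)
        show "\<forall>\<^sub>F x in nhds r. x \<in> UNIV \<longrightarrow> (c +++ d) x = c (2 * x)"
          using eventually_nhds_in_open[of "{..<1/2}" r] r'(1)
          by (auto elim!: eventually_mono simp: joinpaths_def)
      qed auto
      then have "speed G (c +++ d) r = speed G (\<lambda>r. c (2 * r)) r"
        using r' by (simp add: speed_G joinpaths_def)
      with speed_affine[of c 2 r 0] S(2)[OF r'(2)] show "speed G (c +++ d) r = 2 * speed G c (2 * r)"
        by simp
    qed
    have "((\<lambda>r. 2 * speed G d (2 *\<^sub>R r + -1)) has_integral 2 * (integral {0..1} (speed G d) /\<^sub>R 2 ^ DIM(real)))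
       (cbox ((0 - -1) /\<^sub>R 2) ((1 - -1) /\<^sub>R 2))"
      using d unfolding admissible_iff
      by (intro has_integral_mult_right has_integral_affinity') (auto simp: integrable_integral)
    then have "((\<lambda>r. 2 * speed G d (2 * r - 1)) has_integral integral {0..1} (speed G d)) {1/2..1}" by simp
    then have 2: "(speed G (c +++ d) has_integral integral {0..1} (speed G d)) {1/2..1}"
    proof (rule has_integral_spike_finite[rotated -1])
      show "finite (insert (1/2) ((\<lambda>r. (r + 1) / 2) ` S'))" using S' by simp
      fix r assume r: "r \<in> {1/2..1} - insert (1/2) ((\<lambda>r. (r + 1) / 2) ` S')"
      have "2 * r - 1 \<notin> S'" using r image_eqI[of r "\<lambda>r. (r + 1) / 2" "2 * r - 1" S'] by auto
      then have r': "1/2 < r" "2 * r - 1 \<in> {0..1} - S'" using r by auto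
      have "vector_derivative (c +++ d) (at r) = vector_derivative (\<lambda>r. d (2 * r - 1)) (at r)"
      proof (rule vector_derivative_cong_eq)
        show "\<forall>\<^sub>F x in nhds r. x \<in> UNIV \<longrightarrow> (c +++ d) x = d (2 * x - 1)"
          using eventually_nhds_in_open[of "{1/2<..}" r] r'(1)
          by (auto elim!: eventually_mono simp: joinpaths_def)
      qed auto
      then have "speed G (c +++ d) r = speed G (\<lambda>r. d (2 * r - 1)) r"
        using r' by (simp add: speed_G joinpaths_def)
      with speed_affine[of d 2 r "-1"] S'(2)[OF r'(2)] show "speed G (c +++ d) r = 2 * speed G d (2 * r - 1)"
        by simp
    qed
    have int: "(speed G (c +++ d) has_integral integral {0..1} (speed G c) + integral {0..1} (speed G d)) {0..1}"
      by (rule has_integral_combine[OF _ _ 1 2]) auto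
    then have "admissible_curve G p r (c +++ d)"
      using c d unfolding admissible_iff by (auto simp: valid_path_join)
    from dist_le[OF this] int show ?thesis by (simp add: integral_unique)
  qed
  \<comment> \<open>The two infima are taken in turn: over \<open>d\<close> with \<open>c\<close>
    fixed, then over \<open>c\<close>.\<close>
  have "riemannian_dist G p r - integral {0..1} (speed G c) \<le> riemannian_dist G q r"
    if "admissible_curve G p q c" for c
  proof (rule dist_ge)
    fix d assume "admissible_curve G q r d"
    from *[OF that this]
    show "riemannian_dist G p r - integral {0..1} (speed G c) \<le> integral {0..1} (speed G d)" by simp
  qed
  then have "riemannian_dist G p r - riemannian_dist G q r \<le> integral {0..1} (speed G c)"
    if "admissible_curve G p q c" for c using that by (simp add: algebra_simps)
  then have "riemannian_dist G p r - riemannian_dist G q r \<le> riemannian_dist G p q"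
    by (rule dist_ge)
  then show ?thesis by simp
qed

text \<open>A function whose differential is bounded by the metric norm along the curve cannot
  change by more than the length. The parameter \<tau> allows comparison with an intermediate point,
  as needed for a curve that leaves a strip.\<close>

lemma length_ge:
  assumes c: "admissible_curve G p q c" and \<tau>: "0 \<le> \<tau>" "\<tau> \<le> 1"
    and h: "\<And>r. r \<in> {0..\<tau>} \<Longrightarrow> (h has_derivative h' (c r)) (at (c r))"
    and le: "\<And>r v. r \<in> {0..\<tau>} \<Longrightarrow> \<bar>h' (c r) v\<bar> \<le> sqrt (w (c r $ 1)) * norm v"
  shows "\<bar>h (c \<tau>) - h p\<bar> \<le> integral {0..1} (speed G c)"
proof -
  obtain S where S: "finite S" "\<And>r. r \<in> {0..1} - S \<Longrightarrow> c differentiable (at r)"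
    using c valid_path_differentiable unfolding admissible_iff by metis
  have "continuous_on {0..1} c" using c unfolding admissible_curve_def piecewise_C1_differentiable_on_def by auto
  then have c_cont: "continuous_on {0..\<tau>} c" by (rule continuous_on_subset) (use \<tau> in auto)
  define f where "f r = h' (c r) (vector_derivative c (at r))" for r
  have "(f has_integral (h \<circ> c) \<tau> - (h \<circ> c) 0) {0..\<tau>}"
  proof (rule fundamental_theorem_of_calculus_interior_strong[OF S(1) \<tau>(1)])
    fix r assume r: "r \<in> {0<..<\<tau>} - S"
    then have "(c has_vector_derivative vector_derivative c (at r)) (at r)"
      using S(2)[of r] \<tau> by (auto simp: vector_derivative_works)
    from vector_derivative_diff_chain_within[OF this has_derivative_at_withinI[OF h[of r]]] r
    show "((h \<circ> c) has_vector_derivative f r) (at r)" by (simp add: f_def)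
  next
    have "continuous_on (c ` {0..\<tau>}) h"
      using has_derivative_continuous[OF h] by (intro continuous_at_imp_continuous_on) blast
    then show "continuous_on {0..\<tau>} (h \<circ> c)" by (rule continuous_on_compose[OF c_cont])
  qed
  then have f: "f integrable_on {0..\<tau>}" "integral {0..\<tau>} f = h (c \<tau>) - h p"
    using c by (auto simp: integral_unique admissible_curve_def has_integral_integrable)
  have int: "speed G c integrable_on {0..1}" using c by (simp add: admissible_curve_def)
  then have int': "speed G c integrable_on {0..\<tau>}"
    by (rule integrable_on_subinterval) (use \<tau> in auto)
  have "norm (integral {0..\<tau>} f) \<le> integral {0..\<tau>} (speed G c)"
    by (rule integral_norm_bound_integral[OF f(1) int']) (use le in \<open>simp add: f_def speed_G\<close>)
  also have "\<dots> \<le> integral {0..1} (speed G c)"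
    by (rule integral_subset_le[OF _ int' int]) (use \<tau> speed_nonneg in auto)
  finally show ?thesis using f by simp
qed

lemma length_ge_\<sigma>:
  assumes "admissible_curve G p q c" "0 \<le> \<tau>" "\<tau> \<le> 1"
  shows "\<bar>\<sigma> (c \<tau> $ 1) - \<sigma> (p $ 1)\<bar> \<le> integral {0..1} (speed G c)"
proof (rule length_ge[OF assms, where h = "\<lambda>z. \<sigma> (z $ 1)" and h' = "\<lambda>z v. sqrt (w (z $ 1)) * v $ 1"])
  fix r and v :: "real^2"
  show "((\<lambda>z. \<sigma> (z $ 1)) has_derivative (\<lambda>v. sqrt (w (c r $ 1)) * v $ 1)) (at (c r))"
    using has_derivative_compose[where f = "\<lambda>z. z $ 1" and g = \<sigma> and f' = "\<lambda>v. v $ 1",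
        OF bounded_linear_imp_has_derivative[OF bounded_linear_vec_nth]
          \<sigma>_deriv[unfolded has_field_derivative_def]] .
  show "\<bar>sqrt (w (c r $ 1)) * v $ 1\<bar> \<le> sqrt (w (c r $ 1)) * norm v"
    using component_le_norm_cart[of v 1] w_pos[of "c r $ 1"]
    by (simp add: abs_mult mult_left_mono less_imp_le)
qed

lemma dist_ge_\<sigma>: "\<bar>\<sigma> (q $ 1) - \<sigma> (p $ 1)\<bar> \<le> riemannian_dist G p q"
  using length_ge_\<sigma>[of p q _ 1] by (intro dist_ge) (auto simp: admissible_curve_def)

lemma \<sigma>_strict_mono: "x < y \<Longrightarrow> \<sigma> x < \<sigma> y"
  by (rule DERIV_pos_imp_increasing) (auto intro!: exI \<sigma>_deriv simp: w_pos)

text \<open>The bound by \<sigma> separates points with different x. For equal x, a curve either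
  stays in the strip of half-width 1, where sqrt w >= m makes vertical displacement costly, or
  leaves it and pays in \<sigma>.\<close>

lemma dist_eq_0: "riemannian_dist G p q = 0 \<Longrightarrow> p = q"
proof (rule ccontr)
  assume 0: "riemannian_dist G p q = 0" and ne: "p \<noteq> q"
  have "\<sigma> (q $ 1) = \<sigma> (p $ 1)" using dist_ge_\<sigma>[of q p] 0 by simp
  then have 1: "p $ 1 = q $ 1" using \<sigma>_strict_mono by (metis linorder_neqE_linordered_idom less_irrefl)
  then have 2: "p $ 2 \<noteq> q $ 2" using ne by (auto simp: vec_eq_iff forall_2)
  define x where "x = p $ 1"
  have "continuous_on {x - 1..x + 1} (\<lambda>y. sqrt (w y))"
    by (intro continuous_intros continuous_on_subset[OF w_cont]) auto
  then obtain z where z: "z \<in> {x - 1..x + 1}" "\<And>y. y \<in> {x - 1..x + 1} \<Longrightarrow> sqrt (w z) \<le> sqrt (w y)"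
    using continuous_attains_inf[of "{x - 1..x + 1}" "\<lambda>y. sqrt (w y)"] by auto
  define m where "m = sqrt (w z)"
  have m: "m > 0" using w_pos by (simp add: m_def)
  define L where "L = Min {m * \<bar>q $ 2 - p $ 2\<bar>, \<sigma> (x + 1) - \<sigma> x, \<sigma> x - \<sigma> (x - 1)}"
  have L: "0 < L" "L \<le> m * \<bar>q $ 2 - p $ 2\<bar>" "L \<le> \<sigma> (x + 1) - \<sigma> x" "L \<le> \<sigma> x - \<sigma> (x - 1)"
    using m 2 \<sigma>_strict_mono[of x "x + 1"] \<sigma>_strict_mono[of "x - 1" x] by (auto simp: L_def)
  have "L \<le> riemannian_dist G p q"
  proof (rule dist_ge)
    fix c assume c: "admissible_curve G p q c"
    show "L \<le> integral {0..1} (speed G c)"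
    proof (cases "\<forall>r\<in>{0..1}. \<bar>c r $ 1 - x\<bar> \<le> 1")
      case True
      have "\<bar>m * c 1 $ 2 - m * p $ 2\<bar> \<le> integral {0..1} (speed G c)"
      proof (rule length_ge[OF c, where h = "\<lambda>z. m * z $ 2" and h' = "\<lambda>z v. m * v $ 2"])
        fix r :: real and v :: "real^2" assume r: "r \<in> {0..1}"
        show "((\<lambda>z. m * z $ 2) has_derivative (\<lambda>v. m * v $ 2)) (at (c r))"
          by (intro has_derivative_mult_right bounded_linear_imp_has_derivative bounded_linear_vec_nth)
        have "m \<le> sqrt (w (c r $ 1))" unfolding m_def using bspec[OF True r] by (intro z(2)) auto
        then have "m * \<bar>v $ 2\<bar> \<le> sqrt (w (c r $ 1)) * norm v"
          using m component_le_norm_cart[of v 2] by (intro mult_mono) (auto intro: less_imp_le w_pos)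
        then show "\<bar>m * v $ 2\<bar> \<le> sqrt (w (c r $ 1)) * norm v" using m by (simp add: abs_mult)
      qed auto
      moreover have "\<bar>m * c 1 $ 2 - m * p $ 2\<bar> = m * \<bar>q $ 2 - p $ 2\<bar>"
        using m c by (simp add: admissible_curve_def abs_mult flip: right_diff_distrib)
      ultimately show ?thesis using L by linarith
    next
      case False
      then obtain r where r: "0 \<le> r" "r \<le> 1" "c r $ 1 > x + 1 \<or> c r $ 1 < x - 1"
        by (auto simp: abs_le_iff not_le)
      then have "L \<le> \<bar>\<sigma> (c r $ 1) - \<sigma> x\<bar>"
        using L \<sigma>_strict_mono[of "x + 1" "c r $ 1"] \<sigma>_strict_mono[of "c r $ 1" "x - 1"] by auto
      also have "\<dots> \<le> integral {0..1} (speed G c)" using length_ge_\<sigma>[OF c r(1,2)] by (simp add: x_def)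
      finally show ?thesis .
    qed
  qed
  with 0 L show False by simp
qed

text \<open>\<open>complete_metric\<close> is stated through \<open>Metric_space.mcomplete\<close>;
  its Cauchy sequences and limits can be used once the metric axioms hold.\<close>

sublocale riem: Metric_space UNIV "riemannian_dist G"
  using dist_nonneg dist_sym dist_self dist_eq_0 dist_triangle
  by unfold_locales blast+

section \<open>Completeness forces infinite arc length at both ends\<close>

lemma dist_axis: "riemannian_dist G (axis 1 a) (axis 1 b) \<le> \<bar>\<sigma> b - \<sigma> a\<bar>"
proof -
  have *: "riemannian_dist G (axis 1 a) (axis 1 b) \<le> \<sigma> b - \<sigma> a" if "a \<le> b" for a b
  proof -
    let ?c = "linepath (axis 1 a) (axis 1 b :: real^2)"
    have lin: "?c r $ 1 = a + r * (b - a)" for r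
      by (simp add: linepath_def algebra_simps)
    have "axis 1 b - axis 1 a = (b - a) *\<^sub>R (axis 1 1 :: real^2)"
      by (simp add: vec_eq_iff axis_def)
    then have "norm (axis 1 b - axis 1 a :: real^2) = b - a"
      using that by (simp add: norm_axis_1)
    then have speed: "speed G ?c r = sqrt (w (a + r * (b - a))) * (b - a)" for r
      by (simp add: speed_G lin)
    have "((\<lambda>r. \<sigma> (a + r * (b - a))) has_vector_derivative speed G ?c r) (at r within {0..1})" for r
      unfolding speed has_real_derivative_iff_has_vector_derivative[symmetric]
      by (rule DERIV_subset[OF DERIV_chain2[OF \<sigma>_deriv]]) (auto intro!: derivative_eq_intros)
    from fundamental_theorem_of_calculus[OF _ this]
    have "integral {0..1} (speed G ?c) = \<sigma> b - \<sigma> a" by (simp add: integral_unique)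
    then show ?thesis using dist_le[OF admissible_linepath, of "axis 1 a" "axis 1 b"] by simp
  qed
  show ?thesis
    using *[of a b] *[of b a] dist_sym[of "axis 1 a" "axis 1 b"] by linarith
qed

text \<open>If \<sigma> were bounded at one end, the points (n, 0) or (-n, 0) would be Cauchy, yet
  they stay a definite distance from any candidate limit. The sign \<open>e\<close> treats the right
  and left ends together.\<close>

lemma complete_imp_\<sigma>_unbounded:
  assumes "complete_metric G" and e: "e = 1 \<or> e = - 1"
  shows "\<exists>x. B < e * \<sigma> (e * x)"
proof (rule ccontr)
  assume "\<not> ?thesis"
  then have bdd: "e * \<sigma> (e * x) \<le> B" for x by (simp add: not_less)
  define \<tau> where "\<tau> x = e * \<sigma> (e * x)" for x
  have mono: "\<tau> x < \<tau> y" if "x < y" for x y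
    using e
  proof
    assume "e = 1"
    then show ?thesis using \<sigma>_strict_mono[OF that] by (simp add: \<tau>_def)
  next
    assume "e = - 1"
    then show ?thesis using \<sigma>_strict_mono[of "- y" "- x"] that by (simp add: \<tau>_def)
  qed
  define P where "P n = (axis 1 (e * real n) :: real^2)" for n
  have "convergent (\<lambda>n. \<tau> (real n))"
  proof (rule Bseq_monoseq_convergent)
    have le: "\<tau> x \<le> \<tau> y" if "x \<le> y" for x y
      using mono[of x y] that by (cases "x = y") auto
    have "\<bar>\<tau> (real n)\<bar> \<le> max \<bar>B\<bar> \<bar>\<tau> 0\<bar>" for n
      using bdd[of "real n"] le[of 0 "real n"] unfolding \<tau>_def[symmetric] by linarith
    then show "Bseq (\<lambda>n. \<tau> (real n))" by (intro BseqI'[of _ "max \<bar>B\<bar> \<bar>\<tau> 0\<bar>"]) simp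
    show "monoseq (\<lambda>n. \<tau> (real n))"
      unfolding monoseq_def using le by simp
  qed
  then have cauchy: "Cauchy (\<lambda>n. \<tau> (real n))" by (rule convergent_Cauchy)
  have dist_P: "riemannian_dist G (P m) (P n) \<le> \<bar>\<tau> (real m) - \<tau> (real n)\<bar>" for m n
    using dist_axis[of "e * real m" "e * real n"] e by (auto simp: P_def \<tau>_def abs_minus_commute)
  have "riem.MCauchy P"
    unfolding riem.MCauchy_def
  proof (intro conjI allI impI)
    fix \<epsilon> :: real assume "\<epsilon> > 0"
    then obtain N where "\<forall>m\<ge>N. \<forall>n\<ge>N. dist (\<tau> (real m)) (\<tau> (real n)) < \<epsilon>"
      using cauchy unfolding Cauchy_def by blast
    then show "\<exists>N. \<forall>n n'. N \<le> n \<longrightarrow> N \<le> n' \<longrightarrow> riemannian_dist G (P n) (P n') < \<epsilon>"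
      using dist_P unfolding dist_real_def by (meson order_le_less_trans)
  qed auto
  then obtain z where z: "limitin riem.mtopology P z sequentially"
    using assms(1) unfolding complete_metric_def riem.mcomplete_def by blast
  \<comment> \<open>The limit has finite x-coordinate, so once n > k + 1 the sequence is farther
    than \<epsilon> from \<open>z\<close> in arc length.\<close>
  define k where "k = e * z $ 1"
  define \<epsilon> where "\<epsilon> = \<tau> (k + 1) - \<tau> k"
  have "\<epsilon> > 0" using mono[of k "k + 1"] by (simp add: \<epsilon>_def)
  then obtain N where N: "\<And>n. n \<ge> N \<Longrightarrow> riemannian_dist G (P n) z < \<epsilon>"
    using z unfolding riem.limit_metric_sequentially by blast
  obtain n where n: "n \<ge> N" "real n > k + 1"
    by (metis reals_Archimedean2 max.cobounded1 max.cobounded2 of_nat_le_iff order_less_le_trans)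
  have "\<epsilon> \<le> \<tau> (real n) - \<tau> k" using mono[OF n(2)] by (simp add: \<epsilon>_def)
  also have "\<dots> \<le> \<bar>\<sigma> (z $ 1) - \<sigma> (P n $ 1)\<bar>"
    using e by (auto simp: \<tau>_def k_def P_def)
  also have "\<dots> \<le> riemannian_dist G (P n) z" by (rule dist_ge_\<sigma>)
  finally show False using N[OF n(1)] by simp
qed

end

section \<open>The Ricci flow\<close>

lemma pderiv_coord_function_of_x:
  assumes "(h has_real_derivative h') (at (q $ 1))"
  shows "pderiv_coord i (\<lambda>q. h (q $ 1)) q = (if i = 1 then h' else 0)"
proof -
  have "((\<lambda>q. h (q $ 1)) has_derivative (\<lambda>v. h' * v $ 1)) (at q)"
    using has_derivative_compose[where f = "\<lambda>q. q $ 1" and g = h and f' = "\<lambda>v. v $ 1",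
        OF bounded_linear_imp_has_derivative[OF bounded_linear_vec_nth]
          assms[unfolded has_field_derivative_def]] .
  then show ?thesis by (simp add: pderiv_coord_eq axis_def)
qed

text \<open>The conformal formula with w = 1/p gives K = (p/2)(log p)''; the y-term of the Laplacian
  vanishes.\<close>

lemma gauss_curvature_function_of_x:
  fixes p p1 p2 :: "real \<Rightarrow> real"
  assumes "smooth_on (\<lambda>q :: real^2. 1 / p (q $ 1)) UNIV" and pos: "\<And>x. 0 < p x"
    and p: "\<And>x. (p has_real_derivative p1 x) (at x)"
    and p1: "\<And>x. (p1 has_real_derivative p2 x) (at x)"
  shows "gauss_curvature (\<lambda>q. mat (1 / p (q $ 1))) q = (p2 (q $ 1) - (p1 (q $ 1))\<^sup>2 / p (q $ 1)) / 2"
proof -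
  have ln: "(\<lambda>q :: real^2. ln (1 / p (q $ 1))) = (\<lambda>q. - ln (p (q $ 1)))"
    using pos by (simp add: ln_div less_imp_neq[symmetric])
  have d1: "((\<lambda>x. - ln (p x)) has_real_derivative - p1 x / p x) (at x)" for x
    using pos[of x] by (auto intro!: derivative_eq_intros p simp: field_simps)
  have d2: "((\<lambda>x. - p1 x / p x) has_real_derivative - (p2 x - (p1 x)\<^sup>2 / p x) / p x) (at x)" for x
    using pos[of x] by (auto intro!: derivative_eq_intros p p1 simp: field_simps power2_eq_square)
  have "pderiv_coord i (\<lambda>q. - ln (p (q $ 1))) = (\<lambda>q. if i = 1 then - p1 (q $ 1) / p (q $ 1) else 0)" for i
    using pderiv_coord_function_of_x[OF d1] by blast
  moreover have "pderiv_coord 1 (\<lambda>q. - p1 (q $ 1) / p (q $ 1)) q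
      = - (p2 (q $ 1) - (p1 (q $ 1))\<^sup>2 / p (q $ 1)) / p (q $ 1)"
    using pderiv_coord_function_of_x[OF d2, of 1 q] by simp
  ultimately show ?thesis
    using gauss_curvature_conformal[OF assms(1), of q] pos
    by (simp add: ln sum_2 one_neq_two_2 pderiv_coord_const less_imp_neq[symmetric])
qed

theorem theorem1p4:
  fixes T :: ereal and u :: "real \<Rightarrow> real \<Rightarrow> real" and g :: "real \<Rightarrow> real^2 \<Rightarrow> real^2^2"
  assumes "0 < T"
    and "complete_ricci_flow {t. 0 < t \<and> ereal t < T} g"
    and "\<And>t p. 0 < t \<Longrightarrow> ereal t < T \<Longrightarrow> g t p = mat (u (p $ 1) t)"
  shows "\<forall>t p. 0 < t \<and> ereal t < T \<longrightarrow> \<bar>gauss_curvature (g t) p\<bar> \<le> 1 / (2 * t)"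
proof -
  define I where "I = {t. 0 < t \<and> ereal t < T}"
  have openI: "open I"
    unfolding I_def by (intro open_Collect_conj open_Collect_less continuous_intros)
  have open_strip: "open (I \<times> (UNIV :: real set))" "open (I \<times> (UNIV :: (real^2) set))"
    using openI by (auto intro: open_Times)
  have flow: "smooth_ricci_flow I g" and complete: "\<And>t. t \<in> I \<Longrightarrow> complete_metric (g t)"
    using assms(2) by (auto simp: complete_ricci_flow_def I_def)
  have g: "g t = (\<lambda>q. mat (u (q $ 1) t))" if "t \<in> I" for t
    using assms(3) that by (auto simp: I_def)
  have u_pos: "0 < u x t" if "t \<in> I" for t x
  proof -
    have "riemannian_metric (g t)" using flow that by (simp add: smooth_ricci_flow_def)
    \<comment> \<open>Positivity of \<open>u\<close> comes from testing definiteness on the first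
      basis vector at the point (x, 0).\<close>
    then have "0 < (axis 1 1 :: real^2) \<bullet> (g t (axis 1 x) *v axis 1 1)"
      unfolding riemannian_metric_def by (simp add: axis_eq_0_iff)
    then show ?thesis
      by (simp add: g[OF that] inner_vec_def matrix_vector_mult_def sum_2 mat_def axis_def)
  qed
  \<comment> \<open>Defined through \<open>g\<close>, whose joint smoothness is given, and not
    through \<open>u\<close>: smoothness transfers by composition with a linear embedding, and later
    the time derivative of \<open>g\<close> applies to \<open>P\<close> directly.\<close>
  define P where "P = (\<lambda>z :: real \<times> real. inverse (g (fst z) (axis 1 (snd z)) $ 1 $ 1))"
  have P: "P (t, x) = 1 / u x t" if "t \<in> I" for t x
    using that by (simp add: P_def g mat_def axis_def divide_inverse)
  have "smooth_on P (I \<times> UNIV)" unfolding P_def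
  proof (rule smooth_on_inverse[OF open_strip(1)])
    have "smooth_on (\<lambda>(t, q). g t q $ 1 $ 1) (I \<times> UNIV)"
      using flow by (simp add: smooth_ricci_flow_def)
    moreover have "linear (\<lambda>z. (fst z, axis 1 (snd z) :: real^2))"
      by (rule linearI) (auto simp: axis_def vec_eq_iff)
    moreover have "(\<lambda>z. (fst z, axis 1 (snd z) :: real^2)) ` Basis \<subseteq> Basis"
      by (auto simp: Basis_prod_def axis_eq_0_iff axis_in_Basis_iff)
    ultimately have "smooth_on (\<lambda>z. (\<lambda>(t, q). g t q $ 1 $ 1) (fst z, axis 1 (snd z))) (I \<times> (UNIV :: real set))"
      by (intro smooth_on_compose_linear[OF open_strip(2) _ _ open_strip(1)]) auto
    then show "smooth_on (\<lambda>z. g (fst z) (axis 1 (snd z)) $ 1 $ 1) (I \<times> (UNIV :: real set))"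
      by simp
    show "g (fst z) (axis 1 (snd z)) $ 1 $ 1 \<noteq> 0" if "z \<in> I \<times> (UNIV :: real set)" for z
      using that u_pos[of "fst z" "snd z"] by (auto simp: g mat_def axis_def)
  qed
  obtain P' P1 where P1: "smooth_on P1 (I \<times> UNIV)"
    "\<And>t x. (t, x) \<in> I \<times> UNIV \<Longrightarrow> ((\<lambda>t. P (t, x)) has_real_derivative P' (t, x)) (at t)"
    "\<And>t x. (t, x) \<in> I \<times> UNIV \<Longrightarrow> ((\<lambda>x. P (t, x)) has_real_derivative P1 (t, x)) (at x)"
    using smooth_on_partial_derivatives[OF open_strip(1) \<open>smooth_on P _\<close>] by metis
  obtain P1' P2 where P2: "smooth_on P1' (I \<times> UNIV)" "smooth_on P2 (I \<times> UNIV)"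
    "\<And>t x. (t, x) \<in> I \<times> UNIV \<Longrightarrow> ((\<lambda>t. P1 (t, x)) has_real_derivative P1' (t, x)) (at t)"
    "\<And>t x. (t, x) \<in> I \<times> UNIV \<Longrightarrow> ((\<lambda>x. P1 (t, x)) has_real_derivative P2 (t, x)) (at x)"
    using smooth_on_partial_derivatives[OF open_strip(1) P1(1)] by metis
  obtain P2' P3 where P3: "smooth_on P2' (I \<times> UNIV)" "smooth_on P3 (I \<times> UNIV)"
    "\<And>t x. (t, x) \<in> I \<times> UNIV \<Longrightarrow> ((\<lambda>t. P2 (t, x)) has_real_derivative P2' (t, x)) (at t)"
    "\<And>t x. (t, x) \<in> I \<times> UNIV \<Longrightarrow> ((\<lambda>x. P2 (t, x)) has_real_derivative P3 (t, x)) (at x)"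
    using smooth_on_partial_derivatives[OF open_strip(1) P2(2)] by metis
  obtain P4 where P4:
    "\<And>t x. (t, x) \<in> I \<times> UNIV \<Longrightarrow> ((\<lambda>x. P3 (t, x)) has_real_derivative P4 (t, x)) (at x)"
    using smooth_on_partial_derivatives[OF open_strip(1) P3(2)] by metis
  define p p1 p2 p3 p4 where "p t x = P (t, x)" and "p1 t x = P1 (t, x)" and "p2 t x = P2 (t, x)"
    and "p3 t x = P3 (t, x)" and "p4 t x = P4 (t, x)" for t x
  note p_defs = p_def p1_def p2_def p3_def p4_def
  have p_x: "(p t has_real_derivative p1 t x) (at x)" "(p1 t has_real_derivative p2 t x) (at x)"
      "(p2 t has_real_derivative p3 t x) (at x)" "(p3 t has_real_derivative p4 t x) (at x)"
    if "t \<in> I" for t x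
    using that P1(3) P2(4) P3(4) P4 by (auto simp: p_defs[abs_def])
  have cont: "continuous_on (I \<times> UNIV) (\<lambda>(t, x). p t x)" "continuous_on (I \<times> UNIV) (\<lambda>(t, x). p1 t x)"
      "continuous_on (I \<times> UNIV) (\<lambda>(t, x). p2 t x)" "continuous_on (I \<times> UNIV) (\<lambda>(t, x). P1' (t, x))"
      "continuous_on (I \<times> UNIV) (\<lambda>(t, x). P2' (t, x))"
    using \<open>smooth_on P _\<close> P1(1) P2(1,2) P3(1) by (simp_all add: p_defs smooth_on_imp_continuous_on)
  have p_pos: "0 < p t x" if "t \<in> I" for t x using u_pos P that by (simp add: p_def)
  have u_eq: "u x t = 1 / p t x" if "t \<in> I" for t x using P[OF that] by (simp add: p_def)
  have K: "gauss_curvature (g t) q = (p2 t (q $ 1) - (p1 t (q $ 1))\<^sup>2 / p t (q $ 1)) / 2"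
    if "t \<in> I" for t q
  proof -
    have g': "g t = (\<lambda>q. mat (1 / p t (q $ 1)))" using g[OF that] u_eq[OF that] by simp
    have "riemannian_metric (g t)" using flow that by (simp add: smooth_ricci_flow_def)
    then have "smooth_on (\<lambda>q. g t q $ 1 $ 1) UNIV" unfolding riemannian_metric_def by blast
    then have "smooth_on (\<lambda>q :: real^2. 1 / p t (q $ 1)) UNIV" by (simp add: g' mat_def)
    from gauss_curvature_function_of_x[OF this p_pos[OF that] p_x(1,2)[OF that]] show ?thesis
      by (simp add: g')
  qed
  have p_t: "((\<lambda>t. p t x) has_real_derivative p t x * p2 t x - (p1 t x)\<^sup>2) (at t)"
    if t: "t \<in> I" for t x
  proof -
    let ?q = "axis 1 x :: real^2"
    have "((\<lambda>s. g s ?q) has_vector_derivative (- 2 * gauss_curvature (g t) ?q) *\<^sub>R g t ?q) (at t)"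
      using flow t by (simp add: smooth_ricci_flow_def)
    then have "((\<lambda>s. g s ?q $ 1 $ 1) has_vector_derivative
        ((- 2 * gauss_curvature (g t) ?q) *\<^sub>R g t ?q) $ 1 $ 1) (at t)"
      by (intro bounded_linear.has_vector_derivative[OF bounded_linear_vec_nth])
    then have "((\<lambda>s. g s ?q $ 1 $ 1) has_real_derivative
        - 2 * gauss_curvature (g t) ?q * (g t ?q $ 1 $ 1)) (at t)"
      by (simp add: has_real_derivative_iff_has_vector_derivative)
    moreover have gp: "g t ?q $ 1 $ 1 = 1 / p t x" using t by (simp add: g u_eq mat_def axis_def)
    ultimately have D: "((\<lambda>s. g s ?q $ 1 $ 1) has_real_derivative
        - 2 * gauss_curvature (g t) ?q * (1 / p t x)) (at t)" by simp
    have "((\<lambda>s. inverse (g s ?q $ 1 $ 1)) has_real_derivative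
        - (inverse (1 / p t x) * (- 2 * gauss_curvature (g t) ?q * (1 / p t x)) * inverse (1 / p t x))) (at t)"
      using DERIV_inverse'[OF D] gp p_pos[OF t, of x] by simp
    moreover have "(\<lambda>s. inverse (g s ?q $ 1 $ 1)) = (\<lambda>s. p s x)"
      by (simp add: p_def P_def)
    moreover have "- (inverse (1 / p t x) * (- 2 * gauss_curvature (g t) ?q * (1 / p t x)) * inverse (1 / p t x))
        = p t x * p2 t x - (p1 t x)\<^sup>2"
      using p_pos[OF t, of x] by (simp add: K[OF t] axis_def field_simps)
    ultimately show ?thesis by simp
  qed
  have p1_t: "((\<lambda>t. p1 t x) has_real_derivative p t x * p3 t x - p1 t x * p2 t x) (at t)"
    if t: "t \<in> I" for t x
  proof -
    \<comment> \<open>\<open>P1'\<close> is so far an anonymous time derivative of p_x. Exchanging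
      the derivatives identifies it with the x-derivative of the right side of the equation for
      \<open>p\<close>; \<open>P2'\<close> is treated alike below.\<close>
    have "((\<lambda>x. p t x * p2 t x - (p1 t x)\<^sup>2) has_real_derivative P1' (t, x)) (at x)"
      by (rule mixed_partial_derivative[OF openI t, where f = p and f_x = p1 and f_xt = "\<lambda>t x. P1' (t, x)"])
         (use p_x p_t cont P2(3) in \<open>auto simp: p_defs\<close>)
    moreover have "((\<lambda>x. p t x * p2 t x - (p1 t x)\<^sup>2) has_real_derivative
        p t x * p3 t x - p1 t x * p2 t x) (at x)"
      by (auto intro!: derivative_eq_intros p_x t simp: algebra_simps)
    ultimately have "P1' (t, x) = p t x * p3 t x - p1 t x * p2 t x" by (rule DERIV_unique)
    then show ?thesis using P2(3)[of t x] t by (simp add: p_defs)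
  qed
  have p2_t: "((\<lambda>t. p2 t x) has_real_derivative p t x * p4 t x - (p2 t x)\<^sup>2) (at t)"
    if t: "t \<in> I" for t x
  proof -
    have "((\<lambda>x. p t x * p3 t x - p1 t x * p2 t x) has_real_derivative P2' (t, x)) (at x)"
      by (rule mixed_partial_derivative[OF openI t, where f = p1 and f_x = p2 and f_xt = "\<lambda>t x. P2' (t, x)"])
         (use p_x p1_t cont P3(3) in \<open>auto simp: p_defs\<close>)
    moreover have "((\<lambda>x. p t x * p3 t x - p1 t x * p2 t x) has_real_derivative
        p t x * p4 t x - (p2 t x)\<^sup>2) (at x)"
      by (auto intro!: derivative_eq_intros p_x t simp: algebra_simps power2_eq_square)
    ultimately have "P2' (t, x) = p t x * p4 t x - (p2 t x)\<^sup>2" by (rule DERIV_unique)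
    then show ?thesis using P3(3)[of t x] t by (simp add: p_defs)
  qed
  \<comment> \<open>The smaller locale is interpreted first because unboundedness, a hypothesis of
    the larger one, is stated with its \<open>s\<close>.\<close>
  have ld: "log_diffusion I p p1 p2"
  proof
    show "r \<in> I" if "0 < r" "r \<le> t" "t \<in> I" for r t
      using that le_less_trans[of "ereal r" "ereal t" T] by (auto simp: I_def)
  qed (use openI p_pos cont p_x p_t in \<open>auto simp: I_def\<close>)
  have unbounded: "(\<exists>x. B < log_diffusion.s p t x) \<and> (\<exists>x. log_diffusion.s p t x < B)"
    if t: "t \<in> I" for t B
  proof -
    have W: "warped_plane (\<lambda>x. u x t) (log_diffusion.s p t)"
    proof
      have "continuous_on UNIV (p t)" by (rule log_diffusion.continuous_on_slice[OF ld cont(1) t])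
      then show "continuous_on UNIV (\<lambda>x. u x t)"
        using less_imp_neq[OF p_pos[OF t]] by (auto simp: u_eq[OF t] intro!: continuous_intros)
      show "(log_diffusion.s p t has_real_derivative sqrt (u x t)) (at x)" for x
        using log_diffusion.s_x[OF ld t] by (simp add: u_eq[OF t] real_sqrt_divide)
    qed (rule u_pos[OF t])
    have "warped_plane.G (\<lambda>x. u x t) = g t" by (simp add: fun_eq_iff warped_plane.G_def[OF W] g[OF t])
    then have "\<exists>x. B < e * log_diffusion.s p t (e * x)" if "e = 1 \<or> e = - 1" for e B
      using warped_plane.complete_imp_\<sigma>_unbounded[OF W _ that] complete[OF t] by simp
    \<comment> \<open>For e = -1, the bound -B < -s(-x) supplies a point where s is below B.\<close>
    from this[of 1 B] this[of "- 1" "- B"] show ?thesis by (auto simp: minus_less_iff)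
  qed
  have sld: "smooth_log_diffusion I p p1 p2 p3 p4"
    by (intro smooth_log_diffusion.intro ld smooth_log_diffusion_axioms.intro)
       (use p_x p1_t p2_t unbounded in auto)
  show ?thesis
  proof (intro allI impI)
    fix t and q :: "real^2" assume "0 < t \<and> ereal t < T"
    then have "t \<in> I" by (simp add: I_def)
    then show "\<bar>gauss_curvature (g t) q\<bar> \<le> 1 / (2 * t)"
      using smooth_log_diffusion.curvature_bound[OF sld, of t "q $ 1"]
      by (simp add: K smooth_log_diffusion.curvature_def[OF sld])
  qed
qed

end
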